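(* Let $\Phi$ be a stationary point process on $\mathbb{R}^d$. For $k\ge1$ and $\lambda>0$ there exist constants $c(\lambda)$ and $c(\lambda,k)$, not depending on the distribution of $\Phi$, such that: (1) $0<c(\lambda)\le r_c^1(\Phi)$ provided $\Phi\le_{idcx}\Phi_\lambda$; (2) $r_c^k(\Phi)\le c(\lambda,k)<\infty$ provided $\Phi\le_{ddcx}\Phi_\lambda$. Consequently, for $\Phi\le_{dcx}\Phi_\lambda$, combining both statements, $$0<c(\lambda)\le r_c^1(\Phi)\le r_c^k(\Phi)\le c(\lambda,k)<\infty.$$ Here $\Phi_\lambda$ is the homogeneous Poisson point process of intensity $\lambda$ on $\mathbb{R}^d$.
   Context: A point process on $\mathbb{R}^d$ is a random locally finite counting measure, assumed to have Radon mean measure. For a point process $\Phi$, an integer $k\ge1$ and $r\ge0$, the $k$-covered set is $C_k(\Phi,r)=\{x\in\mathbb{R}^d:\sum_{X\in\Phi}\mathbf{1}[x\in B_X(r)]\ge k\}$, where $B_X(r)$ is the (closed) ball of radius $r$ centered at $X$. A set percolates if it has an unbounded connected subset. The critical radius for $k$-percolation is $r_c^k(\Phi)=\inf\{r:\mathsf{P}(C_k(\Phi,r)\text{ percolates})>0\}$. A Lebesgue-measurable $f:\mathbb{R}^m\to\mathbb{R}$ is directionally convex ($dcx$) if for all $x,y,p,q\in\mathbb{R}^m$ with $p\le x\le q$, $p\le y\le q$ (coordinatewise) and $x+y=p+q$ one has $f(x)+f(y)\le f(p)+f(q)$; it is $idcx$ (resp. $ddcx$) if it is $dcx$ and increasing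 (resp. decreasing). For $\mathfrak F\in\{dcx,idcx,ddcx\}$, $\Phi_1\le_{\mathfrak F}\Phi_2$ means that for every $m\ge1$ and all bounded Borel $B_1,\dots,B_m\subset\mathbb{R}^d$, $\mathsf{E}f(\Phi_1(B_1),\dots,\Phi_1(B_m))\le\mathsf{E}f(\Phi_2(B_1),\dots,\Phi_2(B_m))$ for all $f\in\mathfrak F$ for which both expectations are finite.
   Formalization: The upper bounds r_c^k(Φ) ≤ c(λ,k) < ∞ are stated only for d ≥ 2; for d = 1 they fail, since with Φ = Φ_λ gaps longer than 2r occur almost surely in both directions, so r_c^k = ∞. The lower bound and r_c^1 ≤ r_c^k are kept for all d. *)

theory Defs
  imports "HOL-Probability.Probability"
begin

section \<open>Point processes\<close>

definition counting_measures :: "'a::euclidean_space measure set" where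
  "counting_measures =
     {\<phi>. sets \<phi> = sets borel \<and>
          (\<forall>B\<in>sets borel. bounded B \<longrightarrow> (\<exists>n::nat. emeasure \<phi> B = of_nat n))}"

text \<open>The \<open>\<sigma>\<close>-algebra on the configurations is generated by the evaluations \<open>\<phi> \<mapsto> \<phi>(B)\<close>, in the
  same style as \<^const>\<open>subprob_algebra\<close>.\<close>

definition config_algebra :: "'a::euclidean_space measure measure" where
  "config_algebra =
     (SUP B \<in> sets borel. vimage_algebra counting_measures (\<lambda>\<phi>. emeasure \<phi> B) borel)"

text \<open>A point process is represented by its law on the space of configurations. All notions below
  depend on the law only, and this allows quantification over all point processes irrespective of
  the probability space on which they live. The last condition says that the mean measure is
  Radon.\<close>

definition point_process :: "'a::euclidean_space measure measure \<Rightarrow> bool" where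
  "point_process P \<longleftrightarrow>
     prob_space P \<and> sets P = sets config_algebra \<and>
     (\<forall>B\<in>sets borel. bounded B \<longrightarrow> (\<integral>\<^sup>+\<phi>. emeasure \<phi> B \<partial>P) < \<infinity>)"

definition stationary :: "'a::euclidean_space measure measure \<Rightarrow> bool" where
  "stationary P \<longleftrightarrow> (\<forall>a::'a. distr P config_algebra (\<lambda>\<phi>. distr \<phi> borel (\<lambda>x. x + a)) = P)"

text \<open>The Poisson probabilities are written out because \<^const>\<open>poisson_pmf\<close> is meaningful for
  positive rates only, whereas \<open>B\<close> may be a null set here.\<close>

definition poisson_process :: "real \<Rightarrow> 'a::euclidean_space measure measure \<Rightarrow> bool" where
  "poisson_process lam P \<longleftrightarrow>
     point_process P \<and>
     (\<forall>B\<in>sets borel. bounded B \<longrightarrow>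
        (\<forall>n::nat. measure P {\<phi>\<in>space P. emeasure \<phi> B = of_nat n} =
           (lam * measure lborel B) ^ n / fact n * exp (- (lam * measure lborel B)))) \<and>
     (\<forall>(m::nat) B. (\<forall>i<m. B i \<in> sets borel \<and> bounded (B i)) \<and> disjoint_family_on B {..<m} \<longrightarrow>
        prob_space.indep_vars P (\<lambda>_. borel) (\<lambda>i \<phi>. emeasure \<phi> (B i)) {..<m})"

section \<open>Percolation of the \<open>k\<close>-covered set\<close>

text \<open>Integration against the configuration \<open>\<phi>\<close> is summation over its points, with
  multiplicities.\<close>

definition covered_set :: "nat \<Rightarrow> 'a::euclidean_space measure \<Rightarrow> real \<Rightarrow> 'a set" where
  "covered_set k \<phi> r = {x. (\<integral>\<^sup>+X. indicator (cball X r) x \<partial>\<phi>) \<ge> of_nat k}"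

definition percolates :: "'a::euclidean_space set \<Rightarrow> bool" where
  "percolates C \<longleftrightarrow> (\<exists>S\<subseteq>C. connected S \<and> \<not> bounded S)"

text \<open>The infimum is taken in the extended reals, so that it is \<open>\<infinity>\<close> if there is no percolation at
  any radius.\<close>

definition critical_radius :: "nat \<Rightarrow> 'a::euclidean_space measure measure \<Rightarrow> ereal" where
  "critical_radius k P =
     Inf {ereal r | r. 0 \<le> r \<and> measure P {\<phi>\<in>space P. percolates (covered_set k \<phi> r)} > 0}"

section \<open>Directionally convex orders\<close>

text \<open>\<open>\<real>\<^sup>m\<close> is represented by the extensional functions on \<open>{..<m}\<close>, since \<open>m\<close> is quantified inside
  the definition of the orders. The completion of the product Lebesgue-Borel measure expresses
  Lebesgue measurability.\<close>

abbreviation Rvec :: "nat \<Rightarrow> (nat \<Rightarrow> real) set" where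
  "Rvec m \<equiv> {..<m} \<rightarrow>\<^sub>E UNIV"

definition dcx :: "nat \<Rightarrow> ((nat \<Rightarrow> real) \<Rightarrow> real) set" where
  "dcx m =
     {f \<in> borel_measurable (completion (\<Pi>\<^sub>M i\<in>{..<m}. lborel)).
        \<forall>x\<in>Rvec m. \<forall>y\<in>Rvec m. \<forall>p\<in>Rvec m. \<forall>q\<in>Rvec m.
          (\<forall>i<m. p i \<le> x i \<and> x i \<le> q i) \<and> (\<forall>i<m. p i \<le> y i \<and> y i \<le> q i) \<and>
          (\<forall>i<m. x i + y i = p i + q i) \<longrightarrow>
          f x + f y \<le> f p + f q}"

definition idcx :: "nat \<Rightarrow> ((nat \<Rightarrow> real) \<Rightarrow> real) set" where
  "idcx m = {f \<in> dcx m. \<forall>x\<in>Rvec m. \<forall>y\<in>Rvec m. (\<forall>i<m. x i \<le> y i) \<longrightarrow> f x \<le> f y}"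

definition ddcx :: "nat \<Rightarrow> ((nat \<Rightarrow> real) \<Rightarrow> real) set" where
  "ddcx m = {f \<in> dcx m. \<forall>x\<in>Rvec m. \<forall>y\<in>Rvec m. (\<forall>i<m. x i \<le> y i) \<longrightarrow> f y \<le> f x}"

definition counts :: "nat \<Rightarrow> (nat \<Rightarrow> 'a set) \<Rightarrow> 'a::euclidean_space measure \<Rightarrow> nat \<Rightarrow> real" where
  "counts m B \<phi> = (\<lambda>i\<in>{..<m}. measure \<phi> (B i))"

definition le_order ::
  "(nat \<Rightarrow> ((nat \<Rightarrow> real) \<Rightarrow> real) set) \<Rightarrow>
   'a::euclidean_space measure measure \<Rightarrow> 'a measure measure \<Rightarrow> bool" where
  "le_order F P Q \<longleftrightarrow>
     (\<forall>m\<ge>1. \<forall>B. (\<forall>i<m. B i \<in> sets borel \<and> bounded (B i)) \<longrightarrow>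
        (\<forall>f\<in>F m.
           integrable P (\<lambda>\<phi>. f (counts m B \<phi>)) \<and> integrable Q (\<lambda>\<phi>. f (counts m B \<phi>)) \<longrightarrow>
           (\<integral>\<phi>. f (counts m B \<phi>) \<partial>P) \<le> (\<integral>\<phi>. f (counts m B \<phi>) \<partial>Q)))"

end

theory Submission
  imports Defs
begin

text \<open>
  Cut the space into cubes of side \<open>s\<close>. If a ball model of small radius percolates, then some cube
  starts arbitrarily long paths of distinct neighbouring cubes that all contain a point of the
  process; if the \<open>k\<close>-covered set of large radius does not percolate, then, in dimension at least two,
  the cluster of cubes with at least \<open>k\<close> points at the origin is surrounded by a path of cubes with
  fewer points. Either event for a path of \<open>n\<close> cubes forces the total number of points in
  their union \<open>B\<close> to be at least \<open>n\<close>, respectively at most \<open>n (k - 1)\<close>. Such a tail probability is at most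
  the expectation of the convex function \<open>max 0 (x - (n - 1))\<close>, respectively
  \<open>max 0 (n (k - 1) + 1 - x)\<close>, of the single count of \<open>B\<close>, which the order compares with the Poisson
  process; there it decays exponentially in \<open>n\<close>, faster than the number of paths grows when \<open>s\<close> is
  chosen well, and a union bound over paths finishes both parts.
\<close>

section \<open>Lattice cells and lattice paths\<close>

text \<open>Only expectations of counts can be compared, and only when both are finite. The
  piecewise linear test functions are integrable for every point process because the mean measure is
  Radon, whereas an increasing exponential of the count, the usual choice for an upper tail, might
  have infinite mean under \<open>\<Phi>\<close>. Exponentials therefore enter after the comparison,
  on the Poisson side, where the generating function is explicit. A single count suffices because
  the cells of a path are disjoint: the path as a whole is one bounded set of known volume. The
  estimates involve only \<open>DIM('a)\<close>, \<open>lam\<close> and \<open>k\<close>, whence the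
  uniform constants.

  A second obstacle is that percolation quantifies over uncountably many connected sets, while
  \<open>measure\<close> is 0 by default on a set that is not measurable. Positive probability at a
  large radius therefore requires a proof that percolation is an event at all.\<close>

definition lattice :: "'a::euclidean_space set" where
  "lattice = {z. \<forall>i\<in>Basis. z \<bullet> i \<in> \<int>}"

text \<open>Half-open sides make the cells at lattice points a partition of the space when
  \<open>0 < s\<close>, so that counts of cells add up exactly.\<close>

definition cell :: "real \<Rightarrow> 'a::euclidean_space \<Rightarrow> 'a set" where
  "cell s z = {x. \<forall>i\<in>Basis. s * (z \<bullet> i - 1/2) \<le> x \<bullet> i \<and> x \<bullet> i < s * (z \<bullet> i + 1/2)}"

text \<open>Half-open cells that touch diagonally can form a disconnected union; their closures
  share a point, which the connectedness of clusters requires.\<close>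

definition closed_cell :: "real \<Rightarrow> 'a::euclidean_space \<Rightarrow> 'a set" where
  "closed_cell s z = {x. \<forall>i\<in>Basis. \<bar>x \<bullet> i - s * (z \<bullet> i)\<bar> \<le> s / 2}"

text \<open>Any half side strictly between \<open>s / 2\<close> and \<open>s\<close> would do: the fat cells are open
  neighbourhoods of the closed cells, and two of them meet only if the cells are neighbours.\<close>

definition fat_cell :: "real \<Rightarrow> 'a::euclidean_space \<Rightarrow> 'a set" where
  "fat_cell s z = {x. \<forall>i\<in>Basis. \<bar>x \<bullet> i - s * (z \<bullet> i)\<bar> < 5/6 * s}"

text \<open>Distance at most one in the supremum norm. Diagonal neighbours are included because
  closed cells that touch only in a corner still form a connected set.\<close>

definition adjacent :: "'a::euclidean_space \<Rightarrow> 'a \<Rightarrow> bool" where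
  "adjacent z w \<longleftrightarrow> (\<forall>i\<in>Basis. \<bar>z \<bullet> i - w \<bullet> i\<bar> \<le> 1)"

text \<open>Here \<open>n\<close> counts cubes rather than steps. Distinctness makes the cells of a
  path disjoint, so that their union has volume \<open>n * s ^ DIM('a)\<close> and its count is the
  sum of their counts.\<close>

definition lattice_paths :: "'a::euclidean_space \<Rightarrow> nat \<Rightarrow> 'a list set" where
  "lattice_paths z n = {xs. length xs = n \<and> xs \<noteq> [] \<and> hd xs = z \<and> set xs \<subseteq> lattice \<and>
     distinct xs \<and> successively adjacent xs}"

text \<open>The \<open>3 ^ DIM('a)\<close> differences between a lattice point and its neighbours,
  zero included. Its size bounds the branching of lattice paths; the estimates use only that it is
  finite and at least 1.\<close>

definition steps :: "'a::euclidean_space set" where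
  "steps = {v \<in> lattice. \<forall>i\<in>Basis. \<bar>v \<bullet> i\<bar> \<le> 1}"

section \<open>Geometry of lattice points and cells\<close>

lemma adjacent_sym: "adjacent z w \<Longrightarrow> adjacent w z"
  by (simp add: adjacent_def abs_minus_commute)

text \<open>Integer coordinates identify the lattice with integer functions on the finite set
  \<open>Basis\<close>; countability of the lattice and finiteness of \<open>steps\<close> are read
  off from this.\<close>

lemma lattice_eq_image:
  "(lattice :: 'a::euclidean_space set) =
     (\<lambda>f. \<Sum>i\<in>Basis. of_int (f i) *\<^sub>R i) ` (Basis \<rightarrow>\<^sub>E (UNIV :: int set))"
proof (intro equalityI subsetI)
  fix z :: 'a assume z: "z \<in> lattice"
  define f where "f = (\<lambda>i\<in>Basis. \<lfloor>z \<bullet> i\<rfloor>)"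
  have "(\<Sum>i\<in>Basis. of_int (f i) *\<^sub>R i) = (\<Sum>i\<in>Basis. (z \<bullet> i) *\<^sub>R i)"
    using z by (intro sum.cong) (auto simp: f_def lattice_def)
  also have "\<dots> = z" by (rule euclidean_representation)
  finally show "z \<in> (\<lambda>f. \<Sum>i\<in>Basis. of_int (f i) *\<^sub>R i) ` (Basis \<rightarrow>\<^sub>E (UNIV :: int set))"
    by (intro image_eqI[of _ _ f]) (auto simp: f_def)
qed (auto simp: lattice_def inner_sum_left_Basis)

lemma countable_lattice: "countable (lattice :: 'a::euclidean_space set)"
  unfolding lattice_eq_image by (intro countable_image countable_PiE) auto

lemma finite_steps: "finite (steps :: 'a::euclidean_space set)"
proof -
  have "(steps :: 'a set) \<subseteq>
      (\<lambda>f. \<Sum>i\<in>Basis. of_int (f i) *\<^sub>R i) ` (Basis \<rightarrow>\<^sub>E {-1..(1::int)})"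
  proof
    fix z :: 'a assume z: "z \<in> steps"
    then have "z \<in> lattice" by (simp add: steps_def)
    then obtain f :: "'a \<Rightarrow> int" where f: "f \<in> Basis \<rightarrow>\<^sub>E UNIV" "z = (\<Sum>i\<in>Basis. of_int (f i) *\<^sub>R i)"
      unfolding lattice_eq_image by blast
    have "f i \<in> {-1..1}" if "i \<in> Basis" for i
    proof -
      have "z \<bullet> i = of_int (f i)"
        using that by (simp add: f(2) inner_sum_left_Basis)
      with z that have "\<bar>of_int (f i) :: real\<bar> \<le> 1" by (auto simp: steps_def)
      then show ?thesis by auto
    qed
    with f show "z \<in> (\<lambda>f. \<Sum>i\<in>Basis. of_int (f i) *\<^sub>R i) ` (Basis \<rightarrow>\<^sub>E {-1..(1::int)})" by auto
  qed
  then show ?thesis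
    by (rule finite_subset) (intro finite_imageI finite_PiE; simp)
qed

lemma card_steps_ge_1: "1 \<le> card (steps :: 'a::euclidean_space set)"
proof -
  have "(0 :: 'a) \<in> steps" by (auto simp: steps_def lattice_def)
  with finite_steps show ?thesis
    by (metis One_nat_def Suc_leI card_gt_0_iff empty_iff)
qed

lemma open_fat_cell: "open (fat_cell s z)"
proof -
  have "fat_cell s z = (\<Inter>i\<in>Basis. {x. \<bar>x \<bullet> i - s * (z \<bullet> i)\<bar> < 5/6 * s})"
    by (auto simp: fat_cell_def)
  also have "open \<dots>"
    by (intro open_INT ballI open_Collect_less continuous_intros) auto
  finally show ?thesis .
qed

lemma ex_cell:
  assumes "0 < s"
  obtains z where "z \<in> lattice" "x \<in> cell s z"
proof -
  \<comment> \<open>Each coordinate of \<open>x / s\<close> is rounded to a nearest integer; adding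
    \<open>1/2\<close> before taking the floor matches the half-open convention of
    \<open>cell\<close>.\<close>
  define z where "z = (\<Sum>i\<in>Basis. of_int \<lfloor>x \<bullet> i / s + 1/2\<rfloor> *\<^sub>R i)"
  have zi: "z \<bullet> i = of_int \<lfloor>x \<bullet> i / s + 1/2\<rfloor>" if "i \<in> Basis" for i
    using that by (simp add: z_def inner_sum_left_Basis)
  have "s * (z \<bullet> i - 1/2) \<le> x \<bullet> i \<and> x \<bullet> i < s * (z \<bullet> i + 1/2)" if "i \<in> Basis" for i
  proof -
    have "z \<bullet> i \<le> x \<bullet> i / s + 1/2" "x \<bullet> i / s + 1/2 < z \<bullet> i + 1"
      unfolding zi[OF that] by linarith+
    then have "z \<bullet> i - 1/2 \<le> x \<bullet> i / s" "x \<bullet> i / s < z \<bullet> i + 1/2" by linarith+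
    with assms show ?thesis by (simp add: field_simps)
  qed
  then have "x \<in> cell s z" by (simp add: cell_def)
  moreover have "z \<in> lattice" by (auto simp: lattice_def zi)
  ultimately show ?thesis using that by blast
qed

lemma lattice_eqI:
  assumes "z \<in> lattice" "w \<in> lattice" "\<And>i. i \<in> Basis \<Longrightarrow> \<bar>z \<bullet> i - w \<bullet> i\<bar> < 1"
  shows "z = w"
proof (rule euclidean_eqI)
  fix i :: 'a assume i: "i \<in> Basis"
  with assms have "z \<bullet> i - w \<bullet> i \<in> \<int>" by (auto simp: lattice_def)
  with assms(3)[OF i] show "z \<bullet> i = w \<bullet> i"
    by (metis Ints_nonzero_abs_less1 right_minus_eq)
qed

lemma lattice_adjacentI:
  assumes "z \<in> lattice" "w \<in> lattice" "\<And>i. i \<in> Basis \<Longrightarrow> \<bar>z \<bullet> i - w \<bullet> i\<bar> < 2"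
  shows "adjacent z w"
  unfolding adjacent_def
proof
  fix i :: 'a assume i: "i \<in> Basis"
  with assms have "z \<bullet> i - w \<bullet> i \<in> \<int>" by (auto simp: lattice_def)
  then obtain n where n: "z \<bullet> i - w \<bullet> i = of_int n" by (auto elim: Ints_cases)
  with assms(3)[OF i] have "\<bar>n\<bar> \<le> 1" by linarith
  then show "\<bar>z \<bullet> i - w \<bullet> i\<bar> \<le> 1" unfolding n by linarith
qed

lemma cells_disjoint:
  assumes "0 < s" "z \<in> lattice" "w \<in> lattice" "z \<noteq> w"
  shows "cell s z \<inter> cell s w = {}"
proof (rule ccontr)
  assume "cell s z \<inter> cell s w \<noteq> {}"
  then obtain x where x: "x \<in> cell s z" "x \<in> cell s w" by auto
  have "\<bar>z \<bullet> i - w \<bullet> i\<bar> < 1" if "i \<in> Basis" for i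
  proof -
    have "s * (z \<bullet> i - 1/2) < s * (w \<bullet> i + 1/2)" "s * (w \<bullet> i - 1/2) < s * (z \<bullet> i + 1/2)"
      using x that by (force simp: cell_def)+
    with assms(1) have "z \<bullet> i - 1/2 < w \<bullet> i + 1/2" "w \<bullet> i - 1/2 < z \<bullet> i + 1/2"
      by simp_all
    then show ?thesis by linarith
  qed
  with assms lattice_eqI show False by blast
qed

text \<open>The two half sides add up to \<open>5/3 * s < 2 * s\<close>, and integer coordinates
  that differ by less than 2 differ by at most 1.\<close>

lemma fat_cells_adjacent:
  assumes "0 < s" "z \<in> lattice" "w \<in> lattice" "fat_cell s z \<inter> fat_cell s w \<noteq> {}"
  shows "adjacent z w"
proof (rule lattice_adjacentI[OF assms(2,3)])
  fix i :: 'a assume i: "i \<in> Basis"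
  obtain x where "x \<in> fat_cell s z" "x \<in> fat_cell s w" using assms(4) by blast
  then have "\<bar>x \<bullet> i - s * (z \<bullet> i)\<bar> < 5/6 * s" "\<bar>x \<bullet> i - s * (w \<bullet> i)\<bar> < 5/6 * s"
    using i unfolding fat_cell_def by blast+
  then have "\<bar>s * (z \<bullet> i) - s * (w \<bullet> i)\<bar> < s * 2" using assms(1) by argo
  moreover have "\<bar>s * (z \<bullet> i) - s * (w \<bullet> i)\<bar> = s * \<bar>z \<bullet> i - w \<bullet> i\<bar>"
    using assms(1) by (metis abs_mult abs_of_pos right_diff_distrib)
  ultimately have "s * \<bar>z \<bullet> i - w \<bullet> i\<bar> < s * 2" by simp
  with assms(1) show "\<bar>z \<bullet> i - w \<bullet> i\<bar> < 2" by simp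
qed

lemma cell_subset_closed_cell: "cell s z \<subseteq> closed_cell s z"
proof
  fix x assume x: "x \<in> cell s z"
  show "x \<in> closed_cell s z"
    unfolding closed_cell_def mem_Collect_eq
  proof
    fix i :: 'a assume i: "i \<in> Basis"
    have "s * (z \<bullet> i - 1/2) \<le> x \<bullet> i" "x \<bullet> i < s * (z \<bullet> i + 1/2)"
      using x i unfolding cell_def by blast+
    then have "s * (z \<bullet> i) - s / 2 \<le> x \<bullet> i" "x \<bullet> i < s * (z \<bullet> i) + s / 2"
      by (simp_all add: right_diff_distrib distrib_left)
    then show "\<bar>x \<bullet> i - s * (z \<bullet> i)\<bar> \<le> s / 2" by argo
  qed
qed

text \<open>Source of the constant in \<open>fat_cell\<close>: half a side plus the tolerance
  \<open>s / 3\<close> is \<open>5/6 * s\<close>. The same tolerance returns as the condition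
  \<open>r < s / 3\<close> in the lower bound for the critical radius.\<close>

lemma closed_cell_dist_fat_cell:
  assumes "x \<in> closed_cell s z" "dist x y < s / 3"
  shows "y \<in> fat_cell s z"
  unfolding fat_cell_def mem_Collect_eq
proof
  fix i :: 'a assume i: "i \<in> Basis"
  have "\<bar>x \<bullet> i - s * (z \<bullet> i)\<bar> \<le> s / 2"
    using assms(1) i unfolding closed_cell_def by blast
  moreover have "\<bar>(x - y) \<bullet> i\<bar> < s / 3"
    using Basis_le_norm[OF i, of "x - y"] assms(2) by (simp add: dist_norm)
  then have "\<bar>x \<bullet> i - y \<bullet> i\<bar> < s / 3" by (simp add: inner_diff_left)
  ultimately show "\<bar>y \<bullet> i - s * (z \<bullet> i)\<bar> < 5/6 * s" by argo
qed

lemma cell_dist_fat_cell: "\<lbrakk>x \<in> cell s z; dist x y < s / 3\<rbrakk> \<Longrightarrow> y \<in> fat_cell s z"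
  using cell_subset_closed_cell closed_cell_dist_fat_cell by blast

lemma cell_subset_fat_cell: "0 < s \<Longrightarrow> cell s z \<subseteq> fat_cell s z"
  using cell_dist_fat_cell by force

lemma cell_between_boxes:
  fixes z :: "'a::euclidean_space"
  shows "box (s *\<^sub>R z - (s/2) *\<^sub>R One) (s *\<^sub>R z + (s/2) *\<^sub>R One) \<subseteq> cell s z"
    and "cell s z \<subseteq> cbox (s *\<^sub>R z - (s/2) *\<^sub>R One) (s *\<^sub>R z + (s/2) *\<^sub>R One)"
proof -
  have eq: "(s *\<^sub>R z - (s/2) *\<^sub>R One) \<bullet> i = s * (z \<bullet> i - 1/2)"
    "(s *\<^sub>R z + (s/2) *\<^sub>R One) \<bullet> i = s * (z \<bullet> i + 1/2)" if "i \<in> Basis" for i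
    using that by (simp_all add: inner_diff_left inner_add_left right_diff_distrib distrib_left)
  show "box (s *\<^sub>R z - (s/2) *\<^sub>R One) (s *\<^sub>R z + (s/2) *\<^sub>R One) \<subseteq> cell s z"
    "cell s z \<subseteq> cbox (s *\<^sub>R z - (s/2) *\<^sub>R One) (s *\<^sub>R z + (s/2) *\<^sub>R One)"
    by (auto simp only: subset_iff cell_def mem_box mem_Collect_eq eq less_imp_le)
qed

lemma bounded_cell: "bounded (cell s z)"
  by (rule bounded_subset[OF bounded_cbox cell_between_boxes(2)])

lemma cell_borel [measurable]: "cell s z \<in> sets borel"
proof -
  have "cell s z = (\<Inter>i\<in>Basis. {x. s * (z \<bullet> i - 1/2) \<le> x \<bullet> i} \<inter> {x. x \<bullet> i < s * (z \<bullet> i + 1/2)})"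
    by (auto simp: cell_def)
  also have "\<dots> \<in> sets borel"
    by (intro sets.finite_INT sets.Int borel_closed[OF closed_Collect_le]
        borel_open[OF open_Collect_less] continuous_intros; simp)
  finally show ?thesis .
qed

lemma emeasure_cell:
  fixes z :: "'a::euclidean_space"
  assumes "0 < s"
  shows "emeasure lborel (cell s z) = ennreal (s ^ DIM('a))"
proof (rule antisym)
  let ?l = "s *\<^sub>R z - (s/2) *\<^sub>R One" and ?u = "s *\<^sub>R z + (s/2) *\<^sub>R One"
  have lu: "?l \<bullet> i \<le> ?u \<bullet> i" "(?u - ?l) \<bullet> i = s" if "i \<in> Basis" for i
    using that assms by (simp_all add: inner_diff_left inner_add_left)
  then have pr: "(\<Prod>i\<in>Basis. (?u - ?l) \<bullet> i) = s ^ DIM('a)" by simp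
  show "emeasure lborel (cell s z) \<le> ennreal (s ^ DIM('a))"
    using emeasure_mono[OF cell_between_boxes(2)[of s z], of lborel]
    by (simp only: emeasure_lborel_cbox[OF lu(1)] pr sets_lborel borel_closed[OF closed_cbox])
  show "ennreal (s ^ DIM('a)) \<le> emeasure lborel (cell s z)"
    using emeasure_mono[OF cell_between_boxes(1)[of s z], of lborel]
    by (simp only: emeasure_lborel_box[OF lu(1)] pr sets_lborel cell_borel)
qed

text \<open>The norm is at most the sum of the absolute coordinates. This crude estimate is the
  origin of the factor \<open>DIM('a)\<close> in the radii and distances.\<close>

lemma norm_le_sum_coords:
  fixes x :: "'a::euclidean_space" and c :: real
  assumes "\<And>i. i \<in> Basis \<Longrightarrow> \<bar>x \<bullet> i\<bar> \<le> c"
  shows "norm x \<le> DIM('a) * c"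
  using norm_le_l1[of x] sum_mono[of Basis "\<lambda>i. \<bar>x \<bullet> i\<bar>" "\<lambda>_. c"] assms by simp

lemma fat_cell_dist_center:
  fixes z :: "'a::euclidean_space" and s :: real
  assumes "0 < s" "x \<in> fat_cell s z"
  shows "dist (s *\<^sub>R z) x \<le> DIM('a) * s"
  unfolding dist_norm
proof (rule norm_le_sum_coords)
  fix i :: 'a assume "i \<in> Basis"
  with assms have "\<bar>x \<bullet> i - s * (z \<bullet> i)\<bar> < 5/6 * s" by (auto simp: fat_cell_def)
  with assms(1) show "\<bar>(s *\<^sub>R z - x) \<bullet> i\<bar> \<le> s"
    by (simp add: inner_diff_left abs_minus_commute)
qed

section \<open>Counting lattice paths\<close>

lemma adjacent_in_steps:
  assumes "z \<in> lattice" "w \<in> lattice" "adjacent z w"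
  shows "w - z \<in> steps"
  using assms by (auto simp: steps_def lattice_def adjacent_def inner_diff_left abs_minus_commute)

text \<open>A path is its first cube followed by a path from a neighbour. Forgetting that the tail
  must avoid \<open>z\<close> only enlarges the set, which is harmless for an upper bound on the
  number of paths.\<close>

lemma lattice_paths_Suc_Suc:
  "lattice_paths z (Suc (Suc n)) \<subseteq> (#) z ` (\<Union>v\<in>steps. lattice_paths (z + v) (Suc n))"
proof
  fix xs assume xs: "xs \<in> lattice_paths z (Suc (Suc n))"
  then obtain y ys where eq: "xs = z # y # ys"
    by (auto simp: lattice_paths_def length_Suc_conv)
  with xs have "y - z \<in> steps" "y # ys \<in> lattice_paths (z + (y - z)) (Suc n)"
    by (auto simp: lattice_paths_def intro!: adjacent_in_steps)
  with eq show "xs \<in> (#) z ` (\<Union>v\<in>steps. lattice_paths (z + v) (Suc n))" by blast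
qed

lemma card_lattice_paths:
  fixes z :: "'a::euclidean_space"
  shows "finite (lattice_paths z (Suc n)) \<and>
    card (lattice_paths z (Suc n)) \<le> card (steps :: 'a set) ^ n"
proof (induction n arbitrary: z)
  case 0
  have "lattice_paths z (Suc 0) \<subseteq> {[z]}"
    by (auto simp: lattice_paths_def length_Suc_conv)
  then show ?case
    using card_mono[of "{[z]}" "lattice_paths z (Suc 0)"] by (auto intro: finite_subset)
next
  case (Suc n)
  let ?U = "\<Union>v\<in>steps. lattice_paths (z + v) (Suc n)"
  have fin: "finite ?U" using Suc finite_steps by auto
  have "card ?U \<le> (\<Sum>v\<in>(steps :: 'a set). card (lattice_paths (z + v) (Suc n)))"
    by (rule card_UN_le[OF finite_steps])
  also have "\<dots> \<le> (\<Sum>v\<in>(steps :: 'a set). card (steps :: 'a set) ^ n)"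
    by (intro sum_mono) (use Suc in blast)
  finally have "card ?U \<le> card (steps :: 'a set) ^ Suc n" by simp
  moreover have "card (lattice_paths z (Suc (Suc n))) \<le> card ?U"
    using card_mono[OF finite_imageI[OF fin] lattice_paths_Suc_Suc]
      card_image_le[OF fin, of "(#) z"] by linarith
  ultimately show ?case
    using finite_subset[OF lattice_paths_Suc_Suc] fin by auto
qed

lemma take_lattice_paths:
  assumes "xs \<in> lattice_paths z m" "n \<le> m" "0 < n"
  shows "take n xs \<in> lattice_paths z n"
proof -
  have "successively adjacent (take n xs)"
    using assms(1) successively_append_iff[of adjacent "take n xs" "drop n xs"]
    by (auto simp: lattice_paths_def)
  then show ?thesis
    using assms by (auto simp: lattice_paths_def dest: in_set_takeD)
qed

lemma successively_adjacent_dist: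
  assumes "successively adjacent xs" "xs \<noteq> []" "i \<in> Basis"
  shows "\<bar>hd xs \<bullet> i - last xs \<bullet> i\<bar> \<le> real (length xs) - 1"
  using assms
proof (induction xs)
  case (Cons x xs)
  show ?case
  proof (cases "xs = []")
    case False
    with Cons have "\<bar>hd xs \<bullet> i - last xs \<bullet> i\<bar> \<le> real (length xs) - 1" "adjacent x (hd xs)"
      by (auto simp: successively_Cons)
    moreover from this Cons.prems(3) have "\<bar>x \<bullet> i - hd xs \<bullet> i\<bar> \<le> 1"
      unfolding adjacent_def by blast
    ultimately show ?thesis using False by simp
  qed simp
qed simp

section \<open>Lattice paths extracted from connected sets\<close>

lemma rtrancl_imp_path:
  assumes "(a, b) \<in> {(u, v). u \<in> T \<and> v \<in> T \<and> R u v}\<^sup>*" "a \<in> T"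
  obtains xs where "xs \<noteq> []" "hd xs = a" "last xs = b" "set xs \<subseteq> T" "distinct xs"
    "successively R xs"
proof -
  from assms have "\<exists>xs. xs \<noteq> [] \<and> hd xs = a \<and> last xs = b \<and> set xs \<subseteq> T \<and> distinct xs \<and>
      successively R xs"
  proof (induction rule: rtrancl_induct)
    case base
    then show ?case by (intro exI[of _ "[a]"]) auto
  next
    case (step b c)
    then obtain xs where xs: "xs \<noteq> []" "hd xs = a" "last xs = b" "set xs \<subseteq> T" "distinct xs"
      "successively R xs" by blast
    show ?case
    proof (cases "c \<in> set xs")
      \<comment> \<open>Loop erasure: a vertex visited before cuts the path back to its earlier
        occurrence, which keeps the list distinct.\<close>
      case True
      then obtain ys zs where "xs = ys @ c # zs" by (meson split_list)
      with xs show ?thesis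
        by (intro exI[of _ "ys @ [c]"])
          (auto simp: successively_append_iff hd_append split: if_splits)
    next
      case False
      with xs step show ?thesis
        by (intro exI[of _ "xs @ [c]"]) (auto simp: successively_append_iff)
    qed
  qed
  with that show ?thesis by blast
qed

text \<open>The open sets that can be reached from \<open>a\<close> and those that cannot have
  disjoint unions, both open, which together cover \<open>S\<close>. Connectedness rules out that
  both meet \<open>S\<close>.\<close>

lemma connected_chain:
  assumes S: "connected S" "S \<subseteq> (\<Union>z\<in>T. U z)" and op: "\<And>z. open (U z)"
    and a: "a \<in> T" "x \<in> S" "x \<in> U a" and b: "b \<in> T" "y \<in> S" "y \<in> U b"
  shows "(a, b) \<in> {(u, v). u \<in> T \<and> v \<in> T \<and> U u \<inter> U v \<noteq> {}}\<^sup>*" (is "_ \<in> ?R\<^sup>*")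
proof (rule ccontr)
  assume nb: "(a, b) \<notin> ?R\<^sup>*"
  define A where "A = (\<Union>z\<in>{z\<in>T. (a, z) \<in> ?R\<^sup>*}. U z)"
  define B where "B = (\<Union>z\<in>{z\<in>T. (a, z) \<notin> ?R\<^sup>*}. U z)"
  have "A \<inter> B = {}"
  proof (rule ccontr)
    assume "A \<inter> B \<noteq> {}"
    then obtain u v where uv: "u \<in> T" "(a, u) \<in> ?R\<^sup>*" "v \<in> T" "(a, v) \<notin> ?R\<^sup>*" "U u \<inter> U v \<noteq> {}"
      unfolding A_def B_def by blast
    then have "(u, v) \<in> ?R" by blast
    with uv show False by (meson rtrancl.rtrancl_into_rtrancl)
  qed
  moreover have "open A" "open B" using op by (auto simp: A_def B_def)
  moreover have "S \<subseteq> A \<union> B" using S(2) by (auto simp: A_def B_def)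
  moreover have "x \<in> A \<inter> S" "y \<in> B \<inter> S" using a b nb by (auto simp: A_def B_def)
  ultimately show False using connectedD[OF S(1), of A B] by blast
qed

text \<open>The passage from topology to combinatorics. It is applied both to unbounded connected
  sets of covered points and to the frontier that surrounds a bounded cluster.\<close>

lemma fat_cell_path:
  assumes "0 < s" "connected S" "S \<subseteq> (\<Union>z\<in>T. fat_cell s z)" "T \<subseteq> lattice"
    and "a \<in> T" "x \<in> S" "x \<in> fat_cell s a" "b \<in> T" "y \<in> S" "y \<in> fat_cell s b"
  obtains xs where "xs \<in> lattice_paths a (length xs)" "last xs = b" "set xs \<subseteq> T"
proof -
  let ?R = "{(u, v). u \<in> T \<and> v \<in> T \<and> fat_cell s u \<inter> fat_cell s v \<noteq> {}}"
  have ab: "(a, b) \<in> ?R\<^sup>*"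
    by (rule connected_chain[OF assms(2,3) open_fat_cell assms(5-10)])
  have sub: "?R \<subseteq> {(u, v). u \<in> T \<and> v \<in> T \<and> adjacent u v}"
  proof (intro subrelI)
    fix u v assume uv: "(u, v) \<in> ?R"
    then have "u \<in> lattice" "v \<in> lattice" using assms(4) by blast+
    with uv fat_cells_adjacent[OF assms(1) this]
    show "(u, v) \<in> {(u, v). u \<in> T \<and> v \<in> T \<and> adjacent u v}" by simp
  qed
  have "(a, b) \<in> {(u, v). u \<in> T \<and> v \<in> T \<and> adjacent u v}\<^sup>*"
    by (rule subsetD[OF rtrancl_mono[OF sub] ab])
  then obtain xs where xs: "xs \<noteq> []" "hd xs = a" "last xs = b" "set xs \<subseteq> T" "distinct xs"
    "successively adjacent xs"
    using \<open>a \<in> T\<close> by (rule rtrancl_imp_path)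
  then have "xs \<in> lattice_paths a (length xs)"
    using assms(4) unfolding lattice_paths_def by blast
  then show ?thesis using xs(3,4) by (rule that)
qed

section \<open>Counts of a point process\<close>

lemma space_config_algebra: "space config_algebra = counting_measures"
proof -
  have "sets (borel :: 'a measure) \<noteq> {}" by auto
  then show ?thesis by (auto simp: config_algebra_def space_Sup_eq_UN)
qed

lemma measurable_emeasure_config [measurable]:
  assumes "B \<in> sets borel"
  shows "(\<lambda>\<phi>. emeasure \<phi> B) \<in> borel_measurable config_algebra"
  unfolding config_algebra_def
proof (rule measurable_Sup1)
  show "(\<lambda>\<phi>. emeasure \<phi> B) \<in> borel_measurable
      (vimage_algebra counting_measures (\<lambda>\<phi>. emeasure \<phi> B) borel)"
    by (intro measurable_vimage_algebra1) auto
qed (use assms in auto)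

lemma point_processD:
  assumes "point_process P"
  shows "prob_space P" "sets P = sets config_algebra" "space P = counting_measures"
  using assms sets_eq_imp_space_eq[of P config_algebra]
  by (auto simp: point_process_def space_config_algebra)

lemma point_process_measurable:
  assumes "point_process P" "B \<in> sets borel"
  shows "(\<lambda>\<phi>. emeasure \<phi> B) \<in> borel_measurable P"
    and "(\<lambda>\<phi>. measure \<phi> B) \<in> borel_measurable P"
proof -
  show *: "(\<lambda>\<phi>. emeasure \<phi> B) \<in> borel_measurable P"
    using measurable_emeasure_config[OF assms(2)] point_processD(2)[OF assms(1)]
    by (simp cong: measurable_cong_sets)
  show "(\<lambda>\<phi>. measure \<phi> B) \<in> borel_measurable P"
    unfolding measure_def by (intro borel_measurable_enn2real *)
qed

lemma counting_measureE:
  assumes "\<phi> \<in> counting_measures" "B \<in> sets borel" "bounded B"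
  obtains n :: nat where "emeasure \<phi> B = of_nat n" "measure \<phi> B = real n"
proof -
  obtain n :: nat where "emeasure \<phi> B = of_nat n"
    using assms by (auto simp: counting_measures_def)
  moreover from this have "measure \<phi> B = real n"
    by (simp add: measure_def ennreal_of_nat_eq_real_of_nat)
  ultimately show ?thesis using that by blast
qed

lemma point_process_countE:
  assumes "point_process P" "\<phi> \<in> space P" "B \<in> sets borel" "bounded B"
  obtains n :: nat where "emeasure \<phi> B = of_nat n" "measure \<phi> B = real n"
proof -
  have "\<phi> \<in> counting_measures" using assms(2) point_processD(3)[OF assms(1)] by simp
  then show ?thesis using assms(3,4) that by (rule counting_measureE)
qed

lemma integrable_measure_count:
  assumes "point_process P" "B \<in> sets borel" "bounded B"
  shows "integrable P (\<lambda>\<phi>. measure \<phi> B)"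
proof (rule integrableI_bounded)
  show "(\<lambda>\<phi>. measure \<phi> B) \<in> borel_measurable P"
    using point_process_measurable assms by blast
  have "(\<integral>\<^sup>+ \<phi>. ennreal (norm (measure \<phi> B)) \<partial>P) = (\<integral>\<^sup>+ \<phi>. emeasure \<phi> B \<partial>P)"
  proof (rule nn_integral_cong)
    fix \<phi> assume "\<phi> \<in> space P"
    from assms(1) this assms(2,3) obtain n :: nat
      where "emeasure \<phi> B = of_nat n" "measure \<phi> B = real n" by (rule point_process_countE)
    then show "ennreal (norm (measure \<phi> B)) = emeasure \<phi> B"
      by (simp add: ennreal_of_nat_eq_real_of_nat)
  qed
  then show "(\<integral>\<^sup>+ \<phi>. ennreal (norm (measure \<phi> B)) \<partial>P) < \<infinity>"
    using assms by (auto simp: point_process_def)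
qed

text \<open>Linear growth and the Radon mean measure settle the integrability provisos of
  \<open>le_order\<close>, for both processes at once.\<close>

lemma integrable_count_function:
  assumes "point_process P" "B \<in> sets borel" "bounded B" "g \<in> borel_measurable borel"
    and bound: "\<And>x. 0 \<le> x \<Longrightarrow> \<bar>g x\<bar> \<le> C + x"
  shows "integrable P (\<lambda>\<phi>. g (measure \<phi> B) :: real)"
proof (rule Bochner_Integration.integrable_bound)
  interpret prob_space P using point_processD[OF assms(1)] by simp
  show "integrable P (\<lambda>\<phi>. C + measure \<phi> B)"
    using integrable_measure_count[OF assms(1-3)] by simp
  show "(\<lambda>\<phi>. g (measure \<phi> B)) \<in> borel_measurable P"
    using assms(4) point_process_measurable(2)[OF assms(1,2)] by simp
  show "AE \<phi> in P. norm (g (measure \<phi> B)) \<le> norm (C + measure \<phi> B)"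
  proof (rule AE_I2)
    fix \<phi>
    show "norm (g (measure \<phi> B)) \<le> norm (C + measure \<phi> B)"
      using bound[of "measure \<phi> B"] by simp
  qed
qed

section \<open>Convex test functions of a single count\<close>

lemma le_order_counts:
  assumes "le_order F P Q" "(\<lambda>v. g (v 0)) \<in> F 1" "B \<in> sets borel" "bounded B"
    and "integrable P (\<lambda>\<phi>. g (measure \<phi> B))" "integrable Q (\<lambda>\<phi>. g (measure \<phi> B))"
  shows "(\<integral>\<phi>. g (measure \<phi> B) \<partial>P) \<le> (\<integral>\<phi>. g (measure \<phi> B) \<partial>Q)"
proof -
  have c: "counts (Suc 0) (\<lambda>_. B) \<phi> 0 = measure \<phi> B" for \<phi> by (simp add: counts_def)
  show ?thesis
    using assms(1)[unfolded le_order_def, rule_format, of 1 "\<lambda>_. B", OF _ _ assms(2)] assms(3-)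
    by (simp add: c)
qed

lemma dcx_1I:
  assumes [measurable]: "g \<in> borel_measurable borel"
    and "\<And>x y p q. \<lbrakk>p \<le> x; x \<le> q; p \<le> y; y \<le> q; x + y = p + q\<rbrakk> \<Longrightarrow> g x + g y \<le> g p + g q"
  shows "(\<lambda>v. g (v 0) :: real) \<in> dcx 1"
proof -
  have "(\<lambda>v. g (v 0)) \<in> borel_measurable (\<Pi>\<^sub>M i\<in>{..<1::nat}. lborel)" by measurable
  then show ?thesis
    unfolding dcx_def using assms(2) by (simp add: measurable_completion)
qed

lemma max_0_diff_idcx: "(\<lambda>v. max 0 (v 0 - c)) \<in> idcx 1"
proof -
  have "(\<lambda>v. max 0 (v 0 - c)) \<in> dcx 1"
  proof (rule dcx_1I)
    fix x y p q :: real
    assume "p \<le> x" "x \<le> q" "p \<le> y" "y \<le> q" "x + y = p + q"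
    then show "max 0 (x - c) + max 0 (y - c) \<le> max 0 (p - c) + max 0 (q - c)"
      unfolding max_def by argo
  qed simp
  then show ?thesis unfolding idcx_def by (simp add: max.coboundedI2)
qed

lemma max_0_diff_ddcx: "(\<lambda>v. max 0 (c - v 0)) \<in> ddcx 1"
proof -
  have "(\<lambda>v. max 0 (c - v 0)) \<in> dcx 1"
  proof (rule dcx_1I)
    fix x y p q :: real
    assume "p \<le> x" "x \<le> q" "p \<le> y" "y \<le> q" "x + y = p + q"
    then show "max 0 (c - x) + max 0 (c - y) \<le> max 0 (c - p) + max 0 (c - q)"
      unfolding max_def by argo
  qed simp
  then show ?thesis unfolding ddcx_def by (simp add: max.coboundedI2)
qed

section \<open>Exponential estimates by comparison with the Poisson process\<close>

text \<open>A Poisson variable \<open>N\<close> of mean \<open>\<mu>\<close> has generating function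
  \<open>E b^N = exp ((b - 1) * \<mu>)\<close>, and \<open>g\<close> is dominated by
  \<open>C * b ^ n\<close> on the natural numbers. A base above 1 serves upper tails, a base below 1
  lower tails.\<close>

lemma poisson_expectation_le:
  assumes Q: "poisson_process lam Q" and B: "B \<in> sets borel" "bounded B"
    and g: "g \<in> borel_measurable borel"
    and bound: "\<And>n. 0 \<le> g (real n)" "\<And>n. g (real n) \<le> C * b ^ n"
    and nonneg: "0 \<le> C" "0 \<le> b" "0 \<le> lam"
  shows "(\<integral>\<phi>. g (measure \<phi> B) \<partial>Q) \<le> C * exp ((b - 1) * (lam * measure lborel B))"
proof -
  define \<mu> where "\<mu> = lam * measure lborel B"
  have \<mu>: "0 \<le> \<mu>" using nonneg by (simp add: \<mu>_def)
  have pp: "point_process Q" using Q by (simp add: poisson_process_def)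
  note sp = point_processD[OF pp]
  interpret prob_space Q by (rule sp(1))
  note [measurable] = point_process_measurable[OF pp B(1)] g
  define A where "A n = {\<phi> \<in> space Q. emeasure \<phi> B = of_nat n}" for n :: nat
  have A [measurable]: "A n \<in> sets Q" for n unfolding A_def by measurable
  have pA: "emeasure Q (A n) = ennreal (\<mu> ^ n / fact n * exp (- \<mu>))" for n
    using Q B by (simp add: poisson_process_def A_def emeasure_eq_measure \<mu>_def)
  \<comment> \<open>The count takes natural values only, so \<open>g\<close> of it splits over the
    level sets \<open>A n\<close>, whose probabilities are explicit.\<close>
  have pt: "ennreal (g (measure \<phi> B)) = (\<Sum>n. ennreal (g (real n)) * indicator (A n) \<phi>)"
    if \<phi>: "\<phi> \<in> space Q" for \<phi>
  proof -
    from pp \<phi> B obtain m :: nat where m: "emeasure \<phi> B = of_nat m" "measure \<phi> B = real m"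
      by (rule point_process_countE)
    have "(\<Sum>n. ennreal (g (real n)) * indicator (A n) \<phi>) =
        (\<Sum>n\<in>{m}. ennreal (g (real n)) * indicator (A n) \<phi>)"
    proof (rule suminf_finite)
      fix n assume "n \<notin> {m}"
      then have "\<phi> \<notin> A n" unfolding A_def using m(1) by simp
      then show "ennreal (g (real n)) * indicator (A n) \<phi> = 0" by simp
    qed simp
    moreover have "\<phi> \<in> A m" unfolding A_def using m(1) \<phi> by simp
    ultimately show ?thesis using m(2) by simp
  qed
  have sums: "(\<lambda>n. C * b ^ n * (\<mu> ^ n / fact n * exp (- \<mu>))) sums (C * exp ((b - 1) * \<mu>))"
  proof -
    have "(\<lambda>n. (C * exp (- \<mu>)) * ((b * \<mu>) ^ n /\<^sub>R fact n)) sums ((C * exp (- \<mu>)) * exp (b * \<mu>))"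
      by (intro sums_mult exp_converges)
    moreover have "exp (- \<mu>) * exp (b * \<mu>) = exp ((b - 1) * \<mu>)"
      by (simp add: left_diff_distrib flip: exp_add)
    then have "(C * exp (- \<mu>)) * exp (b * \<mu>) = C * exp ((b - 1) * \<mu>)"
      by (simp only: mult.assoc)
    moreover have "(C * exp (- \<mu>)) * ((b * \<mu>) ^ n /\<^sub>R fact n) =
        C * b ^ n * (\<mu> ^ n / fact n * exp (- \<mu>))" for n
      by (simp add: power_mult_distrib divide_inverse mult_ac)
    ultimately show ?thesis by simp
  qed
  have "(\<integral>\<^sup>+\<phi>. ennreal (g (measure \<phi> B)) \<partial>Q) =
      (\<integral>\<^sup>+\<phi>. (\<Sum>n. ennreal (g (real n)) * indicator (A n) \<phi>) \<partial>Q)"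
    by (rule nn_integral_cong) (rule pt)
  also have "\<dots> = (\<Sum>n. \<integral>\<^sup>+\<phi>. ennreal (g (real n)) * indicator (A n) \<phi> \<partial>Q)"
    by (rule nn_integral_suminf) measurable
  also have "\<dots> = (\<Sum>n. ennreal (g (real n)) * emeasure Q (A n))"
    by (simp add: nn_integral_cmult_indicator)
  also have "\<dots> \<le> (\<Sum>n. ennreal (C * b ^ n * (\<mu> ^ n / fact n * exp (- \<mu>))))"
  proof (rule suminf_le[OF _ summableI summableI])
    fix n
    have "g (real n) * (\<mu> ^ n / fact n * exp (- \<mu>)) \<le> C * b ^ n * (\<mu> ^ n / fact n * exp (- \<mu>))"
      using \<mu> by (intro mult_right_mono bound) simp
    moreover have "ennreal (g (real n)) * emeasure Q (A n) =
        ennreal (g (real n) * (\<mu> ^ n / fact n * exp (- \<mu>)))"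
      unfolding pA using \<mu> by (intro ennreal_mult[symmetric] bound) simp
    ultimately show "ennreal (g (real n)) * emeasure Q (A n) \<le>
        ennreal (C * b ^ n * (\<mu> ^ n / fact n * exp (- \<mu>)))"
      by (simp add: ennreal_leI)
  qed
  also have "\<dots> = ennreal (C * exp ((b - 1) * \<mu>))"
    using nonneg \<mu> by (intro suminf_ennreal_eq[OF _ sums]) simp
  finally have le: "(\<integral>\<^sup>+\<phi>. ennreal (g (measure \<phi> B)) \<partial>Q) \<le> ennreal (C * exp ((b - 1) * \<mu>))" .
  have "AE \<phi> in Q. 0 \<le> g (measure \<phi> B)"
  proof (rule AE_I2)
    fix \<phi> assume "\<phi> \<in> space Q"
    from pp this B obtain n :: nat where "measure \<phi> B = real n" by (rule point_process_countE)
    then show "0 \<le> g (measure \<phi> B)" using bound by simp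
  qed
  then have "(\<integral>\<phi>. g (measure \<phi> B) \<partial>Q) = enn2real (\<integral>\<^sup>+\<phi>. ennreal (g (measure \<phi> B)) \<partial>Q)"
    by (intro integral_eq_nn_integral) measurable
  also have "\<dots> \<le> C * exp ((b - 1) * \<mu>)"
    using le nonneg by (intro enn2real_leI) auto
  finally show ?thesis by (simp add: \<mu>_def)
qed

text \<open>Counts are integers, so the kink of the test function can lie at \<open>m\<close>, one
  below the threshold, and the function still dominates the indicator of the event. The base
  \<open>a\<close> is left free so that it can later beat the number of paths.\<close>

lemma idcx_tail_bound:
  assumes P: "point_process P" and Q: "poisson_process lam Q" "0 \<le> lam" and le: "le_order idcx P Q"
    and B: "B \<in> sets borel" "bounded B" and "2 \<le> a"
  shows "measure P {\<phi> \<in> space P. of_nat (Suc m) \<le> emeasure \<phi> B} \<le>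
    exp ((a - 1) * (lam * measure lborel B)) / a ^ m"
proof -
  define g where "g = (\<lambda>x :: real. max 0 (x - real m))"
  have pQ: "point_process Q" using Q by (simp add: poisson_process_def)
  have g [measurable]: "g \<in> borel_measurable borel" by (simp add: g_def)
  have int: "integrable R (\<lambda>\<phi>. g (measure \<phi> B))" if "point_process R" for R :: "'a measure measure"
    by (rule integrable_count_function[OF that B g, of 0]) (auto simp: g_def)
  interpret prob_space P using point_processD[OF P] by simp
  note [measurable] = point_process_measurable[OF P B(1)]
  let ?A = "{\<phi> \<in> space P. of_nat (Suc m) \<le> emeasure \<phi> B}"
  have A: "?A \<in> sets P" by measurable
  have "measure P ?A = (\<integral>\<phi>. indicator ?A \<phi> \<partial>P)" using A by simp
  also have "\<dots> \<le> (\<integral>\<phi>. g (measure \<phi> B) \<partial>P)"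
  proof (rule integral_mono[OF _ int[OF P]])
    show "integrable P (indicator ?A :: _ \<Rightarrow> real)" using A by (simp add: emeasure_eq_measure)
    fix \<phi> assume "\<phi> \<in> space P"
    from P this B obtain n :: nat where n: "emeasure \<phi> B = of_nat n" "measure \<phi> B = real n"
      by (rule point_process_countE)
    show "indicator ?A \<phi> \<le> g (measure \<phi> B)"
    proof (cases "Suc m \<le> n")
      case False
      then have "\<phi> \<notin> ?A" unfolding mem_Collect_eq n(1) of_nat_le_iff by blast
      then show ?thesis by (simp add: g_def)
    qed (simp add: n(2) g_def indicator_def)
  qed
  also have "\<dots> \<le> (\<integral>\<phi>. g (measure \<phi> B) \<partial>Q)"
    using max_0_diff_idcx[of "real m"]
    by (intro le_order_counts[OF le _ B int[OF P] int[OF pQ]]) (simp add: g_def)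
  also have "\<dots> \<le> (1 / a ^ m) * exp ((a - 1) * (lam * measure lborel B))"
  proof (rule poisson_expectation_le[OF Q(1) B g])
    fix n
    show "g (real n) \<le> 1 / a ^ m * a ^ n"
    proof (cases "m \<le> n")
      case True
      \<comment> \<open>With \<open>j = n - m\<close> this is
        \<open>j \<le> 2 ^ j \<le> a ^ j\<close>, the place where \<open>2 \<le> a\<close>
        enters.\<close>
      have "real (n - m) \<le> 2 ^ (n - m)"
        using less_exp[of "n - m"] by (metis less_imp_le of_nat_le_iff of_nat_numeral of_nat_power)
      also have "\<dots> \<le> a ^ (n - m)" using \<open>2 \<le> a\<close> by (intro power_mono) auto
      also have "\<dots> = 1 / a ^ m * a ^ n" using \<open>2 \<le> a\<close> True by (simp add: power_diff)
      finally show ?thesis using True by (simp add: g_def of_nat_diff)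
    qed (use \<open>2 \<le> a\<close> in \<open>simp add: g_def\<close>)
  qed (use \<open>2 \<le> a\<close> Q(2) in \<open>simp_all add: g_def\<close>)
  finally show ?thesis by simp
qed

text \<open>Base \<open>exp (-1)\<close>: the factor \<open>exp (-1) - 1\<close> is negative, so for
  \<open>0 < lam\<close> the bound decays exponentially in the volume of \<open>B\<close>, which for
  large cubes outweighs the factor \<open>exp (real m + 1)\<close>.\<close>

lemma ddcx_tail_bound:
  assumes P: "point_process P" and Q: "poisson_process lam Q" "0 \<le> lam" and le: "le_order ddcx P Q"
    and B: "B \<in> sets borel" "bounded B"
  shows "measure P {\<phi> \<in> space P. emeasure \<phi> B \<le> of_nat m} \<le>
    exp (real m + 1) * exp ((exp (-1) - 1) * (lam * measure lborel B))"
proof -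
  define g where "g = (\<lambda>x :: real. max 0 (real m + 1 - x))"
  have pQ: "point_process Q" using Q by (simp add: poisson_process_def)
  have g [measurable]: "g \<in> borel_measurable borel" by (simp add: g_def)
  have int: "integrable R (\<lambda>\<phi>. g (measure \<phi> B))" if "point_process R" for R :: "'a measure measure"
    by (rule integrable_count_function[OF that B g, of "real m + 1"]) (auto simp: g_def)
  interpret prob_space P using point_processD[OF P] by simp
  note [measurable] = point_process_measurable[OF P B(1)]
  let ?A = "{\<phi> \<in> space P. emeasure \<phi> B \<le> of_nat m}"
  have A: "?A \<in> sets P" by measurable
  have "measure P ?A = (\<integral>\<phi>. indicator ?A \<phi> \<partial>P)" using A by simp
  also have "\<dots> \<le> (\<integral>\<phi>. g (measure \<phi> B) \<partial>P)"
  proof (rule integral_mono[OF _ int[OF P]])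
    show "integrable P (indicator ?A :: _ \<Rightarrow> real)" using A by (simp add: emeasure_eq_measure)
    fix \<phi> assume "\<phi> \<in> space P"
    from P this B obtain n :: nat where n: "emeasure \<phi> B = of_nat n" "measure \<phi> B = real n"
      by (rule point_process_countE)
    show "indicator ?A \<phi> \<le> g (measure \<phi> B)"
    proof (cases "n \<le> m")
      case False
      then have "\<phi> \<notin> ?A" unfolding mem_Collect_eq n(1) of_nat_le_iff by blast
      then show ?thesis by (simp add: g_def)
    qed (simp add: n(2) g_def indicator_def)
  qed
  also have "\<dots> \<le> (\<integral>\<phi>. g (measure \<phi> B) \<partial>Q)"
    using max_0_diff_ddcx[of "real m + 1"]
    by (intro le_order_counts[OF le _ B int[OF P] int[OF pQ]]) (simp add: g_def)
  also have "\<dots> \<le> exp (real m + 1) * exp ((exp (-1) - 1) * (lam * measure lborel B))"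
  proof (rule poisson_expectation_le[OF Q(1) B g])
    fix n
    \<comment> \<open>From \<open>t + 1 \<le> exp t\<close> and \<open>0 < exp t\<close> follows
      \<open>max 0 t \<le> exp t\<close>.\<close>
    have "g (real n) \<le> exp (real m + 1 - real n)"
      using exp_ge_add_one_self[of "real m + 1 - real n"]
      by (simp add: g_def)
    also have "\<dots> = exp (real m + 1) * exp (-1) ^ n"
      by (simp flip: exp_add exp_of_nat_mult)
    finally show "g (real n) \<le> exp (real m + 1) * exp (-1) ^ n" .
  qed (use Q(2) in \<open>simp_all add: g_def\<close>)
  finally show ?thesis .
qed

section \<open>Measurability of percolation\<close>

lemma covered_set_eq:
  assumes "\<phi> \<in> counting_measures"
  shows "covered_set k \<phi> r = {x. of_nat k \<le> emeasure \<phi> (cball x r)}"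
proof -
  have s: "sets \<phi> = sets borel" using assms by (simp add: counting_measures_def)
  have "(\<integral>\<^sup>+X. indicator (cball X r) x \<partial>\<phi>) = emeasure \<phi> (cball x r)" for x
  proof -
    have "(\<integral>\<^sup>+X. indicator (cball X r) x \<partial>\<phi>) = (\<integral>\<^sup>+X. indicator (cball x r) X \<partial>\<phi>)"
      by (intro nn_integral_cong) (simp add: indicator_def dist_commute)
    then show ?thesis by (simp add: s)
  qed
  then show ?thesis by (simp add: covered_set_def)
qed

text \<open>Continuity from above: the slightly enlarged balls around \<open>x\<close> decrease to
  \<open>cball x r\<close>, all have finite count, and each contains an approximating ball, hence at
  least \<open>k\<close> points.\<close>

lemma covered_set_approx:
  assumes phi: "\<phi> \<in> counting_measures"
    and approx: "\<And>e. 0 < e \<Longrightarrow> \<exists>y. dist y x < e \<and> of_nat k \<le> emeasure \<phi> (cball y (r + e))"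
  shows "x \<in> covered_set k \<phi> r"
proof -
  have s: "sets \<phi> = sets borel" using phi by (simp add: counting_measures_def)
  \<comment> \<open>One unit \<open>1 / real (Suc n)\<close> pays for the displacement of the
    centre, the other for the enlarged radius.\<close>
  define A where "A n = cball x (r + 2 / real (Suc n))" for n
  have k: "of_nat k \<le> emeasure \<phi> (A n)" for n
  proof -
    obtain y where y: "dist y x < 1 / real (Suc n)"
      "of_nat k \<le> emeasure \<phi> (cball y (r + 1 / real (Suc n)))"
      using approx[of "1 / real (Suc n)"] by auto
    have "cball y (r + 1 / real (Suc n)) \<subseteq> A n"
    proof
      fix w assume "w \<in> cball y (r + 1 / real (Suc n))"
      moreover have "dist x w \<le> dist y x + dist y w" by (metis dist_commute dist_triangle)
      moreover have "2 / real (Suc n) = 1 / real (Suc n) + 1 / real (Suc n)" by simp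
      ultimately show "w \<in> A n"
        using y(1) unfolding A_def mem_cball by linarith
    qed
    then have "emeasure \<phi> (cball y (r + 1 / real (Suc n))) \<le> emeasure \<phi> (A n)"
      by (intro emeasure_mono) (simp_all add: s A_def)
    with y(2) show ?thesis by simp
  qed
  have sub: "(\<Inter>n. A n) \<subseteq> cball x r"
  proof
    fix w assume w: "w \<in> (\<Inter>n. A n)"
    show "w \<in> cball x r"
    proof (rule ccontr)
      assume "w \<notin> cball x r"
      then have "0 < (dist x w - r) / 2" by simp
      from reals_Archimedean[OF this] obtain n where "1 / real (Suc n) < (dist x w - r) / 2"
        unfolding inverse_eq_divide ..
      moreover have "w \<in> A n" using w by blast
      then have "dist x w \<le> r + 2 / real (Suc n)" unfolding A_def mem_cball .
      moreover have "2 / real (Suc n) = 1 / real (Suc n) + 1 / real (Suc n)" by simp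
      ultimately show False by argo
    qed
  qed
  have "of_nat k \<le> (INF n. emeasure \<phi> (A n))" using k by (rule INF_greatest)
  also have "\<dots> = emeasure \<phi> (\<Inter>n. A n)"
  proof (rule INF_emeasure_decseq)
    show "decseq A"
    proof (rule decseq_SucI)
      fix n
      have "2 / real (Suc (Suc n)) \<le> 2 / real (Suc n)" by (simp add: frac_le)
      then show "A (Suc n) \<subseteq> A n" unfolding A_def by (intro subset_cball) simp
    qed
    fix n
    have "A n \<in> sets borel" "bounded (A n)" by (simp_all add: A_def)
    with phi obtain m :: nat where "emeasure \<phi> (A n) = of_nat m" by (rule counting_measureE)
    then show "emeasure \<phi> (A n) \<noteq> \<infinity>" by simp
  qed (simp add: s A_def image_subset_iff)
  also have "emeasure \<phi> (\<Inter>n. A n) \<le> emeasure \<phi> (cball x r)"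
    by (intro emeasure_mono sub) (simp add: s)
  finally show ?thesis by (simp add: covered_set_eq[OF phi])
qed

lemma closed_covered_set:
  assumes phi: "\<phi> \<in> counting_measures"
  shows "closed (covered_set k \<phi> r)"
  unfolding closure_subset_eq[symmetric]
proof
  fix x assume "x \<in> closure (covered_set k \<phi> r)"
  then have x: "\<forall>e>0. \<exists>y\<in>covered_set k \<phi> r. dist y x < e" by (simp add: closure_approachable)
  have s: "sets \<phi> = sets borel" using phi by (simp add: counting_measures_def)
  show "x \<in> covered_set k \<phi> r"
  proof (rule covered_set_approx[OF phi])
    fix e :: real assume e: "0 < e"
    then obtain y where y: "y \<in> covered_set k \<phi> r" "dist y x < e" using x by blast
    from y(1) have "of_nat k \<le> emeasure \<phi> (cball y r)" by (simp add: covered_set_eq[OF phi])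
    also have "\<dots> \<le> emeasure \<phi> (cball y (r + e))"
      using e by (intro emeasure_mono subset_cball) (simp_all add: s)
    finally show "\<exists>y. dist y x < e \<and> of_nat k \<le> emeasure \<phi> (cball y (r + e))"
      using y(2) by blast
  qed
qed

text \<open>Percolation is the existence of arbitrarily long and fine chains of lattice points that are
  almost covered; the chains range over a countable set.\<close>

definition coarse_path :: "nat \<Rightarrow> 'a::euclidean_space measure \<Rightarrow> real \<Rightarrow> real \<Rightarrow> 'a list \<Rightarrow> bool" where
  "coarse_path k \<phi> r s xs \<longleftrightarrow>
     (\<forall>z\<in>set xs. of_nat k \<le> emeasure \<phi> (cball (s *\<^sub>R z) (r + real DIM('a) * s)))"

text \<open>A subset of the countable set \<open>lists lattice\<close>. The start is confined by
  \<open>n\<close>, the end has to leave the ball of radius \<open>N\<close>; repetitions are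
  allowed.\<close>

definition crossings :: "real \<Rightarrow> nat \<Rightarrow> nat \<Rightarrow> 'a::euclidean_space list set" where
  "crossings s n N = {xs \<in> lists lattice. xs \<noteq> [] \<and> successively adjacent xs \<and>
     norm (s *\<^sub>R hd xs) \<le> real n \<and> real N \<le> norm (s *\<^sub>R last xs)}"

section \<open>Percolation expressed by coarse chains\<close>

lemma norm_le_norm_add_dist:
  fixes x y :: "'a::real_normed_vector"
  shows "norm x \<le> norm y + dist x y"
  by (metis dist_norm norm_triangle_sub)

lemma percolates_imp_crossing:
  fixes \<phi> :: "'a::euclidean_space measure"
  assumes phi: "\<phi> \<in> counting_measures" and perc: "percolates (covered_set k \<phi> r)"
  shows "\<exists>n. \<forall>m N. \<exists>xs\<in>crossings (1 / real (Suc m)) n N. coarse_path k \<phi> r (1 / real (Suc m)) xs"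
proof -
  have sb: "sets \<phi> = sets borel" using phi by (simp add: counting_measures_def)
  obtain S where S: "S \<subseteq> covered_set k \<phi> r" "connected S" "\<not> bounded S"
    using perc by (auto simp: percolates_def)
  then obtain x0 where x0: "x0 \<in> S" by fastforce
  \<comment> \<open>One \<open>n\<close> has to serve all meshes. Since \<open>s \<le> 1\<close>,
    the cell centre assigned to \<open>x0\<close> is never farther than \<open>DIM('a)\<close> from
    it.\<close>
  obtain n :: nat where n: "norm x0 + real DIM('a) \<le> real n" using real_arch_simple by blast
  show ?thesis
  proof (intro exI allI)
    fix m N :: nat
    define s where "s = 1 / real (Suc m)"
    have s: "0 < s" "s \<le> 1" by (simp_all add: s_def)
    then have Ds: "real DIM('a) * s \<le> real DIM('a)" by simp
    obtain y where y: "y \<in> S" "real N + real DIM('a) < norm y"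
      using S(3) unfolding bounded_iff by (meson not_le)
    define T where "T = {z \<in> lattice. of_nat k \<le> emeasure \<phi> (cball (s *\<^sub>R z) (r + real DIM('a) * s))}"
    have near: "\<exists>z\<in>T. x \<in> fat_cell s z" if x: "x \<in> S" for x
    proof -
      obtain z where z: "z \<in> lattice" "x \<in> cell s z" using ex_cell[OF s(1)] .
      then have xz: "x \<in> fat_cell s z" using cell_subset_fat_cell[OF s(1)] by blast
      \<comment> \<open>The extra radius in \<open>coarse_path\<close> is the bound for the distance
        between a point and the centre of its cell.\<close>
      have sub: "cball x r \<subseteq> cball (s *\<^sub>R z) (r + real DIM('a) * s)"
      proof
        fix w assume "w \<in> cball x r"
        with fat_cell_dist_center[OF s(1) xz] dist_triangle[of "s *\<^sub>R z" w x]
        show "w \<in> cball (s *\<^sub>R z) (r + real DIM('a) * s)" unfolding mem_cball by argo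
      qed
      have "of_nat k \<le> emeasure \<phi> (cball x r)" using x S(1) covered_set_eq[OF phi, of k r] by blast
      also have "\<dots> \<le> emeasure \<phi> (cball (s *\<^sub>R z) (r + real DIM('a) * s))"
        by (intro emeasure_mono sub) (simp add: sb)
      finally have "z \<in> T" using z(1) by (simp add: T_def)
      with xz show ?thesis by blast
    qed
    obtain a b where ab: "a \<in> T" "x0 \<in> fat_cell s a" "b \<in> T" "y \<in> fat_cell s b"
      using near[OF x0] near[OF y(1)] by blast
    have "S \<subseteq> (\<Union>z\<in>T. fat_cell s z)" using near by blast
    moreover have "T \<subseteq> lattice" by (auto simp: T_def)
    ultimately obtain xs where xs: "xs \<in> lattice_paths a (length xs)" "last xs = b" "set xs \<subseteq> T"
      using fat_cell_path[OF s(1) S(2) _ _ ab(1) x0 ab(2,3) y(1) ab(4)] by metis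
    have "norm (s *\<^sub>R a) \<le> norm x0 + dist (s *\<^sub>R a) x0" "norm y \<le> norm (s *\<^sub>R b) + dist (s *\<^sub>R b) y"
      using norm_le_norm_add_dist[of "s *\<^sub>R a" x0] norm_le_norm_add_dist[of y "s *\<^sub>R b"]
      by (simp_all only: dist_commute)
    moreover have "dist (s *\<^sub>R a) x0 \<le> real DIM('a)" "dist (s *\<^sub>R b) y \<le> real DIM('a)"
      using order_trans[OF fat_cell_dist_center[OF s(1)] Ds] ab(2,4) by blast+
    ultimately have "norm (s *\<^sub>R a) \<le> real n" "real N \<le> norm (s *\<^sub>R b)"
      using n y(2) by linarith+
    with xs have "xs \<in> crossings s n N"
      unfolding crossings_def lattice_paths_def by blast
    moreover have "coarse_path k \<phi> r s xs"
      using xs(3) unfolding coarse_path_def T_def by blast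
    ultimately show "\<exists>xs\<in>crossings (1 / real (Suc m)) n N. coarse_path k \<phi> r (1 / real (Suc m)) xs"
      unfolding s_def by blast
  qed
qed

text \<open>Compactness: otherwise there are almost covered points in the fixed ball, at ever finer
  meshes, that keep distance \<open>\<eta>\<close> from the covered set. A limit point of them is
  itself covered, a contradiction.\<close>

lemma coarse_points_near_covered_set:
  fixes \<phi> :: "'a::euclidean_space measure"
  assumes phi: "\<phi> \<in> counting_measures" and "0 < \<eta>"
  shows "\<exists>m. real DIM('a) * (1 / real (Suc m)) < \<eta> \<and>
    (\<forall>p\<in>cball 0 R. of_nat k \<le> emeasure \<phi> (cball p (r + real DIM('a) * (1 / real (Suc m)))) \<longrightarrow>
      (\<exists>c\<in>covered_set k \<phi> r. dist p c < \<eta>))"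
proof (rule ccontr)
  have sb: "sets \<phi> = sets borel" using phi by (simp add: counting_measures_def)
  have lim: "(\<lambda>m. real DIM('a) * (1 / real (Suc m))) \<longlonglongrightarrow> 0"
    using tendsto_mult_right_zero[OF LIMSEQ_inverse_real_of_nat, of "real DIM('a)"]
    by (simp add: divide_inverse)
  have ev: "\<forall>\<^sub>F m in sequentially. real DIM('a) * (1 / real (Suc m)) < e" if "0 < e" for e
    using order_tendstoD(2)[OF lim that] .
  obtain M where M: "\<And>m. M \<le> m \<Longrightarrow> real DIM('a) * (1 / real (Suc m)) < \<eta>"
    using ev[OF \<open>0 < \<eta>\<close>] unfolding eventually_sequentially by blast
  assume contr: "\<not> ?thesis"
  \<comment> \<open>The shift by \<open>M\<close> makes the mesh condition hold, so the negated
    claim must fail in its second part.\<close>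
  have "\<exists>p\<in>cball 0 R. of_nat k \<le> emeasure \<phi> (cball p (r + real DIM('a) * (1 / real (Suc (M + m))))) \<and>
      (\<forall>c\<in>covered_set k \<phi> r. \<not> dist p c < \<eta>)" for m
    using contr M[OF le_add1[of M m]] by blast
  then obtain p where p: "\<And>m. p m \<in> cball 0 R"
    "\<And>m. of_nat k \<le> emeasure \<phi> (cball (p m) (r + real DIM('a) * (1 / real (Suc (M + m)))))"
    "\<And>m c. c \<in> covered_set k \<phi> r \<Longrightarrow> \<not> dist (p m) c < \<eta>"
    by metis
  obtain l h where h: "strict_mono (h :: nat \<Rightarrow> nat)" "(p \<circ> h) \<longlonglongrightarrow> l"
    using p(1) compact_cball[of "0 :: 'a" R] unfolding compact_def by metis
  have "l \<in> covered_set k \<phi> r"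
  proof (rule covered_set_approx[OF phi])
    fix e :: real assume e: "0 < e"
    obtain m1 where m1: "\<And>m. m1 \<le> m \<Longrightarrow> real DIM('a) * (1 / real (Suc m)) < e"
      using ev[OF e] unfolding eventually_sequentially by blast
    obtain m2 where m2: "\<And>m. m2 \<le> m \<Longrightarrow> dist ((p \<circ> h) m) l < e"
      using tendstoD[OF h(2) e] unfolding eventually_sequentially by blast
    define j where "j = max m1 m2"
    have "m1 \<le> M + h j" using seq_suble[OF h(1), of j] by (simp add: j_def)
    then have small: "real DIM('a) * (1 / real (Suc (M + h j))) < e" by (rule m1)
    note p(2)[of "h j"]
    also have "emeasure \<phi> (cball (p (h j)) (r + real DIM('a) * (1 / real (Suc (M + h j))))) \<le>
        emeasure \<phi> (cball (p (h j)) (r + e))"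
      using small by (intro emeasure_mono subset_cball) (simp_all add: sb)
    finally show "\<exists>y. dist y l < e \<and> of_nat k \<le> emeasure \<phi> (cball y (r + e))"
      using m2[of j] by (auto simp: j_def)
  qed
  moreover obtain j where "dist ((p \<circ> h) j) l < \<eta>"
    using tendstoD[OF h(2) \<open>0 < \<eta>\<close>] unfolding eventually_sequentially by blast
  ultimately show False using p(3) by simp
qed

text \<open>A bounded component of a closed set need not be relatively open, as other components may
  accumulate at it. By the Sura-Bura theorem it still has compact relatively open neighbourhoods,
  and finitely many of these cover \<open>L\<close>.\<close>

lemma bounded_components_clopen:
  fixes S :: "'a::euclidean_space set"
  assumes "closed S" "compact L" "L \<subseteq> S"
    and bdd: "\<And>T. \<lbrakk>T \<subseteq> S; connected T\<rbrakk> \<Longrightarrow> bounded T"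
  obtains K where "compact K" "closed (S - K)" "L \<subseteq> K" "K \<subseteq> S"
proof -
  have "\<exists>K. openin (top_of_set S) K \<and> compact K \<and> x \<in> K" if x: "x \<in> S" for x
  proof -
    let ?C = "connected_component_set S x"
    have C: "?C \<in> components S" using x by (simp add: components_iff) blast
    have "closed ?C" using closed_components[OF assms(1) C] .
    moreover have "bounded ?C"
      by (intro bdd connected_component_subset connected_connected_component)
    ultimately have "compact ?C" by (simp add: compact_eq_bounded_closed)
    from Sura_Bura_clopen_subset[OF closed_imp_locally_compact[OF assms(1)] C this open_UNIV]
    obtain K where "openin (top_of_set S) K" "compact K" "?C \<subseteq> K" by auto
    moreover have "x \<in> ?C" using x by simp
    ultimately show ?thesis by blast
  qed
  then obtain K where K: "\<And>x. x \<in> S \<Longrightarrow> openin (top_of_set S) (K x) \<and> compact (K x) \<and> x \<in> K x"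
    by metis
  then have "\<exists>G. open G \<and> K x = S \<inter> G" if "x \<in> S" for x
    using that unfolding openin_open by blast
  then obtain G where G: "\<And>x. x \<in> S \<Longrightarrow> open (G x) \<and> K x = S \<inter> G x" by metis
  obtain F where F: "F \<subseteq> L" "finite F" "L \<subseteq> (\<Union>x\<in>F. G x)"
  proof (rule compactE_image[OF assms(2), of L G])
    show "open (G x)" if "x \<in> L" for x using G that assms(3) by blast
    show "L \<subseteq> (\<Union>x\<in>L. G x)" using G K assms(3) by blast
  qed blast
  have FS: "F \<subseteq> S" using F(1) assms(3) by blast
  show ?thesis
  proof
    show "compact (\<Union>x\<in>F. K x)" using F(2) K FS by (intro compact_UN) auto
    have "S - (\<Union>x\<in>F. K x) = S - (\<Union>x\<in>F. G x)" using G FS by blast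
    moreover have "open (\<Union>x\<in>F. G x)" using G FS by blast
    ultimately show "closed (S - (\<Union>x\<in>F. K x))" using assms(1) by (simp add: closed_Diff)
    show "L \<subseteq> (\<Union>x\<in>F. K x)" using F(3) G FS assms(3) by blast
    show "(\<Union>x\<in>F. K x) \<subseteq> S" using G FS by blast
  qed
qed

text \<open>Without percolation the covered points near the origin lie in a compact part
  \<open>K\<close> at distance \<open>\<delta>\<close> from all other covered points. A chain that
  is fine compared with \<open>\<delta>\<close> cannot jump this gap, so it stays near
  \<open>K\<close> and cannot escape to distance \<open>N\<close>.\<close>

lemma crossing_imp_percolates:
  fixes \<phi> :: "'a::euclidean_space measure"
  assumes phi: "\<phi> \<in> counting_measures"
    and cross: "\<And>m N. \<exists>xs\<in>crossings (1 / real (Suc m)) n N. coarse_path k \<phi> r (1 / real (Suc m)) xs"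
  shows "percolates (covered_set k \<phi> r)"
proof (rule ccontr)
  let ?C = "covered_set k \<phi> r"
  assume "\<not> percolates ?C"
  then have bdd: "\<And>T. \<lbrakk>T \<subseteq> ?C; connected T\<rbrakk> \<Longrightarrow> bounded T" by (auto simp: percolates_def)
  have cl: "closed ?C" by (rule closed_covered_set[OF phi])
  obtain K where K: "compact K" "closed (?C - K)" "?C \<inter> cball 0 (real n + 1) \<subseteq> K" "K \<subseteq> ?C"
    by (rule bounded_components_clopen[OF cl closed_Int_compact[OF cl compact_cball] _ bdd]) auto
  obtain \<delta> where \<delta>: "0 < \<delta>" "\<And>x y. \<lbrakk>x \<in> K; y \<in> ?C - K\<rbrakk> \<Longrightarrow> \<delta> \<le> dist x y"
    using separate_compact_closed[OF K(1,2)] by blast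
  obtain N0 where N0: "\<And>x. x \<in> K \<Longrightarrow> norm x \<le> N0"
    using compact_imp_bounded[OF K(1)] unfolding bounded_iff by blast
  \<comment> \<open>The slack 2 keeps a neighbour of any chain point near \<open>K\<close> inside
    the ball of radius \<open>N\<close>, where almost covered points are known to be close to
    covered ones.\<close>
  obtain N :: nat where N: "max N0 (real n) + 2 \<le> real N" using real_arch_simple by blast
  \<comment> \<open>Three distances of size \<open>\<eta>\<close> separate the covered points
    assigned to consecutive chain points: out to the chain, along it, and back. Hence
    \<open>3 * \<eta> < \<delta>\<close> is needed.\<close>
  define \<eta> where "\<eta> = min 1 (\<delta> / 4)"
  have \<eta>: "0 < \<eta>" "\<eta> \<le> 1" "3 * \<eta> < \<delta>" using \<delta>(1) by (auto simp: \<eta>_def)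
  obtain m where m: "real DIM('a) * (1 / real (Suc m)) < \<eta>"
    "\<And>p. \<lbrakk>p \<in> cball 0 (real N); of_nat k \<le> emeasure \<phi> (cball p (r + real DIM('a) * (1 / real (Suc m))))\<rbrakk>
      \<Longrightarrow> \<exists>c\<in>?C. dist p c < \<eta>"
    using coarse_points_near_covered_set[OF phi \<eta>(1)] by blast
  define s where "s = 1 / real (Suc m)"
  have s: "0 < s" by (simp add: s_def)
  obtain xs where xs: "xs \<in> crossings s n N" "coarse_path k \<phi> r s xs"
    using cross[of m N] unfolding s_def by blast
  \<comment> \<open>Closeness to \<open>K\<close> is inherited by the next chain point: its covered
    point lies within \<open>3 * \<eta>\<close> of \<open>K\<close> and therefore belongs to
    \<open>K\<close>.\<close>
  have step: "\<exists>c\<in>K. dist (s *\<^sub>R w) c < \<eta>"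
    if z: "\<exists>c\<in>K. dist (s *\<^sub>R z) c < \<eta>" and "adjacent z w" and
      w: "of_nat k \<le> emeasure \<phi> (cball (s *\<^sub>R w) (r + real DIM('a) * s))" for z w :: 'a
  proof -
    obtain c where c: "c \<in> K" "dist (s *\<^sub>R z) c < \<eta>" using z by blast
    have "norm (z - w) \<le> real DIM('a) * 1"
      using \<open>adjacent z w\<close> by (intro norm_le_sum_coords) (simp add: adjacent_def inner_diff_left)
    then have "s * norm (z - w) \<le> s * real DIM('a)" using s by simp
    then have "dist (s *\<^sub>R z) (s *\<^sub>R w) \<le> real DIM('a) * s"
      using s by (simp add: dist_norm mult.commute flip: scaleR_diff_right)
    then have zw: "dist (s *\<^sub>R z) (s *\<^sub>R w) < \<eta>" using m(1) by (simp add: s_def)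
    have "norm (s *\<^sub>R w) \<le> norm c + dist (s *\<^sub>R z) c + dist (s *\<^sub>R z) (s *\<^sub>R w)"
      using norm_le_norm_add_dist[of "s *\<^sub>R w" c] dist_triangle3[of "s *\<^sub>R w" c "s *\<^sub>R z"]
      by argo
    then have "s *\<^sub>R w \<in> cball 0 (real N)" using c zw N0[OF c(1)] N \<eta>(2) by simp
    with m(2) w obtain c' where c': "c' \<in> ?C" "dist (s *\<^sub>R w) c' < \<eta>" unfolding s_def by blast
    have "dist c c' \<le> dist (s *\<^sub>R z) c + dist (s *\<^sub>R z) (s *\<^sub>R w) + dist (s *\<^sub>R w) c'"
      using dist_triangle3[of c c' "s *\<^sub>R z"] dist_triangle[of "s *\<^sub>R z" c' "s *\<^sub>R w"] by argo
    then have "dist c c' < \<delta>" using c(2) zw c'(2) \<eta>(3) by simp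
    then have "c' \<in> K" using \<delta>(2)[OF c(1)] c'(1) by force
    with c' show ?thesis by blast
  qed
  have propagate: "\<exists>c\<in>K. dist (s *\<^sub>R last xs) c < \<eta>"
    if "xs \<noteq> []" "\<exists>c\<in>K. dist (s *\<^sub>R hd xs) c < \<eta>" "successively adjacent xs"
      "coarse_path k \<phi> r s xs" for xs :: "'a list"
    using that
  proof (induction xs)
    case (Cons x xs)
    show ?case
    proof (cases "xs = []")
      case False
      have "adjacent x (hd xs)" "successively adjacent xs" "coarse_path k \<phi> r s xs"
        using Cons.prems False by (auto simp: successively_Cons coarse_path_def)
      moreover have "of_nat k \<le> emeasure \<phi> (cball (s *\<^sub>R hd xs) (r + real DIM('a) * s))"
        using Cons.prems(4) False by (simp add: coarse_path_def)
      ultimately have "\<exists>c\<in>K. dist (s *\<^sub>R last xs) c < \<eta>"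
        using Cons.IH[OF False] step[of x "hd xs"] Cons.prems(2) by simp
      then show ?thesis using False by simp
    qed (use Cons.prems in simp)
  qed simp
  have ne: "xs \<noteq> []" "successively adjacent xs" "norm (s *\<^sub>R hd xs) \<le> real n"
    "real N \<le> norm (s *\<^sub>R last xs)"
    using xs(1) by (simp_all add: crossings_def)
  have "\<exists>c\<in>K. dist (s *\<^sub>R hd xs) c < \<eta>"
  proof -
    have "of_nat k \<le> emeasure \<phi> (cball (s *\<^sub>R hd xs) (r + real DIM('a) * s))"
      using xs(2) ne(1) by (simp add: coarse_path_def)
    moreover have "s *\<^sub>R hd xs \<in> cball 0 (real N)" unfolding mem_cball_0 using ne(3) N by linarith
    ultimately obtain c where c: "c \<in> ?C" "dist (s *\<^sub>R hd xs) c < \<eta>"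
      using m(2) unfolding s_def by blast
    have "norm c \<le> norm (s *\<^sub>R hd xs) + dist (s *\<^sub>R hd xs) c"
      using norm_le_norm_add_dist[of c "s *\<^sub>R hd xs"] by (simp only: dist_commute)
    then have "c \<in> cball 0 (real n + 1)" unfolding mem_cball_0 using c(2) ne(3) \<eta>(2) by linarith
    with c K(3) show ?thesis by blast
  qed
  with propagate[OF ne(1) _ ne(2) xs(2)] obtain c where c: "c \<in> K" "dist (s *\<^sub>R last xs) c < \<eta>"
    by blast
  have "norm (s *\<^sub>R last xs) \<le> norm c + dist (s *\<^sub>R last xs) c"
    by (rule norm_le_norm_add_dist)
  with c(2) N0[OF c(1)] N \<eta>(2) ne(4) show False by linarith
qed

text \<open>In the description by chains every quantifier runs over a countable set, and each chain
  is tested by finitely many counts of balls.\<close>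

lemma percolates_measurable:
  fixes P :: "'a::euclidean_space measure measure"
  assumes P: "point_process P"
  shows "{\<phi> \<in> space P. percolates (covered_set k \<phi> r)} \<in> sets P"
proof -
  have count: "{\<phi> \<in> space P. of_nat k \<le> emeasure \<phi> (cball x \<rho>)} \<in> sets P" for x \<rho>
    by (intro borel_measurable_le borel_measurable_const point_process_measurable(1)[OF P]) simp
  let ?X = "\<lambda>m n N \<phi>. \<exists>xs\<in>crossings (1 / real (Suc m)) n N. coarse_path k \<phi> r (1 / real (Suc m)) xs"
  have "{\<phi> \<in> space P. ?X m n N \<phi>} \<in> sets P" for m n N
  proof (rule sets.sets_Collect_countable_Ex')
    fix xs :: "'a list"
    show "{\<phi> \<in> space P. coarse_path k \<phi> r (1 / real (Suc m)) xs} \<in> sets P"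
      unfolding coarse_path_def by (intro sets.sets_Collect_finite_All count finite_set)
    have "crossings (1 / real (Suc m)) n N \<subseteq> lists (lattice :: 'a set)"
      by (auto simp: crossings_def)
    then show "countable (crossings (1 / real (Suc m)) n N :: 'a list set)"
      by (rule countable_subset) (rule countable_lists[OF countable_lattice])
  qed
  then have "{\<phi> \<in> space P. \<exists>n. \<forall>m N. ?X m n N \<phi>} \<in> sets P"
    by (intro sets.sets_Collect_countable_Ex sets.sets_Collect_countable_All)
  moreover have "percolates (covered_set k \<phi> r) \<longleftrightarrow> (\<exists>n. \<forall>m N. ?X m n N \<phi>)"
    if "\<phi> \<in> space P" for \<phi>
  proof -
    have "\<phi> \<in> counting_measures" using that point_processD(3)[OF P] by simp
    then show ?thesis using percolates_imp_crossing crossing_imp_percolates by blast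
  qed
  then have "{\<phi> \<in> space P. percolates (covered_set k \<phi> r)} =
      {\<phi> \<in> space P. \<exists>n. \<forall>m N. ?X m n N \<phi>}" by blast
  ultimately show ?thesis by simp
qed

section \<open>The lower bound\<close>

lemma disjoint_family_cells:
  assumes "0 < s" "F \<subseteq> lattice"
  shows "disjoint_family_on (cell s) F"
  using cells_disjoint[OF assms(1)] assms(2) unfolding disjoint_family_on_def by blast

lemma measure_cells:
  fixes F :: "'a::euclidean_space set" and s :: real
  assumes "0 < s" "finite F" "F \<subseteq> lattice"
  shows "measure lborel (\<Union>w\<in>F. cell s w) = real (card F) * s ^ DIM('a)"
proof -
  have e: "emeasure lborel (cell s w) = ennreal (s ^ DIM('a))" for w :: 'a
    by (rule emeasure_cell[OF assms(1)])
  then have m: "measure lborel (cell s w) = s ^ DIM('a)" for w :: 'a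
    unfolding measure_def using assms(1) by simp
  have "measure lborel (\<Union>w\<in>F. cell s w) = (\<Sum>w\<in>F. measure lborel (cell s w))"
    by (rule measure_finite_Union[OF assms(2) _ disjoint_family_cells[OF assms(1,3)]])
      (simp_all add: e image_subset_iff cell_borel)
  then show ?thesis by (simp add: m)
qed

lemma emeasure_cells:
  assumes "\<phi> \<in> counting_measures" "0 < s" "finite F" "F \<subseteq> lattice"
  shows "emeasure \<phi> (\<Union>w\<in>F. cell s w) = (\<Sum>w\<in>F. emeasure \<phi> (cell s w))"
proof -
  have "sets \<phi> = sets borel" using assms(1) by (simp add: counting_measures_def)
  then show ?thesis
    by (intro sum_emeasure[symmetric] disjoint_family_cells assms)
      (simp add: image_subset_iff cell_borel)
qed

lemma cells_borel: "finite F \<Longrightarrow> (\<Union>w\<in>F. cell s w) \<in> sets borel"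
  by (intro sets.finite_UN cell_borel)

lemma bounded_cells: "finite F \<Longrightarrow> bounded (\<Union>w\<in>F. cell s w)"
  by (intro bounded_UN ballI bounded_cell)

section \<open>Small radii: long occupied paths\<close>

text \<open>The starting cube is fixed before \<open>n\<close>: paths from it to cubes around ever
  more distant points of \<open>S\<close> are long enough to be cut to any prescribed
  length.\<close>

lemma long_lattice_path:
  fixes S :: "'a::euclidean_space set"
  assumes s: "0 < s" and S: "connected S" "\<not> bounded S" "S \<subseteq> (\<Union>z\<in>T. fat_cell s z)"
    and T: "T \<subseteq> lattice"
  shows "\<exists>a\<in>lattice. \<forall>n. \<exists>xs\<in>lattice_paths a (Suc n). set xs \<subseteq> T"
proof -
  from S(2) obtain x0 where x0: "x0 \<in> S" by fastforce
  with S(3) obtain a where a: "a \<in> T" "x0 \<in> fat_cell s a" by blast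
  have "\<exists>xs\<in>lattice_paths a (Suc n). set xs \<subseteq> T" for n
  proof -
    define D where "D = real DIM('a) * s"
    define E where "E = real DIM('a) * (s * real n)"
    \<comment> \<open>Here \<open>2 * D\<close> pays for the distances of \<open>x0\<close> and
      \<open>y\<close> from their cell centres, and \<open>E\<close> is the distance that
      \<open>n\<close> steps cannot exceed.\<close>
    obtain y where y: "y \<in> S" "norm x0 + 2 * D + E < norm y"
      using S(2) unfolding bounded_iff by (meson not_le)
    with S(3) obtain b where b: "b \<in> T" "y \<in> fat_cell s b" by blast
    obtain xs where xs: "xs \<in> lattice_paths a (length xs)" "last xs = b" "set xs \<subseteq> T"
      using fat_cell_path[OF s S(1,3) T a(1) x0 a(2) b(1) y(1) b(2)] by metis
    have "dist (s *\<^sub>R a) x0 \<le> D" "dist (s *\<^sub>R b) y \<le> D"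
      unfolding D_def using fat_cell_dist_center[OF s] a(2) b(2) by blast+
    moreover have "norm y \<le> norm x0 + dist (s *\<^sub>R a) x0 + dist (s *\<^sub>R a) (s *\<^sub>R b) + dist (s *\<^sub>R b) y"
      using norm_le_norm_add_dist[of y x0] dist_triangle[of y x0 "s *\<^sub>R b"]
        dist_triangle[of "s *\<^sub>R b" x0 "s *\<^sub>R a"]
      unfolding dist_commute[of y "s *\<^sub>R b"] dist_commute[of "s *\<^sub>R b" "s *\<^sub>R a"] by argo
    ultimately have far: "E < norm (s *\<^sub>R a - s *\<^sub>R b)" unfolding dist_norm using y(2) by argo
    have "\<exists>i\<in>Basis. real n < \<bar>a \<bullet> i - b \<bullet> i\<bar>"
    proof (rule ccontr)
      assume "\<not> ?thesis"
      then have le: "\<bar>a \<bullet> i - b \<bullet> i\<bar> \<le> real n" if "i \<in> Basis" for i using that by force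
      have "norm (s *\<^sub>R a - s *\<^sub>R b) \<le> E"
        unfolding E_def
      proof (rule norm_le_sum_coords)
        fix i :: 'a assume "i \<in> Basis"
        from le[OF this] s have "s * \<bar>a \<bullet> i - b \<bullet> i\<bar> \<le> s * real n" by simp
        moreover have "\<bar>(s *\<^sub>R a - s *\<^sub>R b) \<bullet> i\<bar> = s * \<bar>a \<bullet> i - b \<bullet> i\<bar>"
          using s by (simp add: abs_mult inner_diff_left flip: scaleR_diff_right)
        ultimately show "\<bar>(s *\<^sub>R a - s *\<^sub>R b) \<bullet> i\<bar> \<le> s * real n" by simp
      qed
      with far show False by simp
    qed
    then obtain i where i: "i \<in> Basis" "real n < \<bar>a \<bullet> i - b \<bullet> i\<bar>" by blast
    have "successively adjacent xs" "xs \<noteq> []" "hd xs = a"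
      using xs(1) by (simp_all add: lattice_paths_def)
    from successively_adjacent_dist[OF this(1,2) i(1)] this(3) xs(2) i(2)
    have "Suc n \<le> length xs" by simp
    then have "take (Suc n) xs \<in> lattice_paths a (Suc n)"
      using take_lattice_paths[OF xs(1)] by simp
    moreover have "set (take (Suc n) xs) \<subseteq> T" using xs(3) set_take_subset by (rule subset_trans[rotated])
    ultimately show ?thesis by blast
  qed
  then show ?thesis using a(1) T by blast
qed

text \<open>Configurations are measures, so no point is picked. If all cells that meet the ball had
  count less than 1, hence 0, the ball would be covered by countably many null sets and could not
  have count 1. As \<open>r < s / 3\<close>, the fat cells of all these cells contain
  \<open>x\<close>.\<close>

lemma covered_point_in_occupied_fat_cell:
  assumes phi: "\<phi> \<in> counting_measures" and s: "0 < s" "r < s / 3"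
    and x: "x \<in> covered_set 1 \<phi> r"
  shows "\<exists>z\<in>lattice. 1 \<le> emeasure \<phi> (cell s z) \<and> x \<in> fat_cell s z"
proof -
  have sb: "sets \<phi> = sets borel" using phi by (simp add: counting_measures_def)
  define Z where "Z = {z \<in> lattice. cell s z \<inter> cball x r \<noteq> {}}"
  have fat: "x \<in> fat_cell s z" if "z \<in> Z" for z
  proof -
    obtain w where "w \<in> cell s z" "dist x w \<le> r" using \<open>z \<in> Z\<close> unfolding Z_def by fastforce
    then show ?thesis using cell_dist_fat_cell[of w s z x] s(2) by (simp add: dist_commute)
  qed
  have "\<exists>z\<in>Z. 1 \<le> emeasure \<phi> (cell s z)"
  proof (rule ccontr)
    assume none: "\<not> ?thesis"
    have null: "cell s z \<in> null_sets \<phi>" if "z \<in> Z" for z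
    proof -
      obtain n :: nat where n: "emeasure \<phi> (cell s z) = of_nat n"
        using phi cell_borel bounded_cell by (rule counting_measureE)
      have "\<not> 1 \<le> emeasure \<phi> (cell s z)" using none that by blast
      then have "\<not> (of_nat 1 :: ennreal) \<le> of_nat n" unfolding n of_nat_1 .
      then have "n = 0" unfolding of_nat_le_iff by simp
      then show ?thesis using n by (simp add: null_sets_def sb cell_borel)
    qed
    have "countable Z" using countable_lattice by (rule countable_subset[rotated]) (auto simp: Z_def)
    then have "(\<Union>z\<in>Z. cell s z) \<in> null_sets \<phi>" using null by (rule null_sets_UN')
    moreover have "cball x r \<subseteq> (\<Union>z\<in>Z. cell s z)"
    proof
      fix w assume w: "w \<in> cball x r"
      obtain z where "z \<in> lattice" "w \<in> cell s z" using ex_cell[OF s(1)] .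
      with w show "w \<in> (\<Union>z\<in>Z. cell s z)" unfolding Z_def by blast
    qed
    ultimately have "cball x r \<in> null_sets \<phi>"
      using null_sets_subset[of _ \<phi> "cball x r"] by (simp add: sb)
    then have "emeasure \<phi> (cball x r) = 0" by auto
    moreover have "of_nat 1 \<le> emeasure \<phi> (cball x r)" using x covered_set_eq[OF phi, of 1 r] by blast
    ultimately show False by simp
  qed
  with fat show ?thesis unfolding Z_def by blast
qed

text \<open>With base \<open>2 * K\<close> in the tail bound, at most \<open>K ^ n\<close> paths
  leave \<open>2 ^ n\<close> in the denominator, while the Poisson factor contributes less than 2
  per cube. So paths of every length from a given cube exist with probability 0, and there are
  countably many starting cubes.\<close>

lemma measure_percolates_eq_0:
  fixes P Q :: "'a::euclidean_space measure measure" and s :: real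
  assumes P: "point_process P" and Q: "poisson_process lam Q" "0 \<le> lam" and le: "le_order idcx P Q"
    and s: "0 < s" "r < s / 3"
    and small: "exp ((2 * real (card (steps :: 'a set)) - 1) * (lam * s ^ DIM('a))) < 2"
  shows "measure P {\<phi> \<in> space P. percolates (covered_set 1 \<phi> r)} = 0"
proof -
  interpret prob_space P using point_processD[OF P] by simp
  define K where "K = real (card (steps :: 'a set))"
  have K: "1 \<le> K" using card_steps_ge_1[where 'a='a] by (simp add: K_def)
  define e where "e = exp ((2 * K - 1) * (lam * s ^ DIM('a)))"
  have e: "0 < e" "e < 2" using small by (simp_all add: e_def K_def)
  define A where "A n xs = {\<phi> \<in> space P. of_nat (Suc n) \<le> emeasure \<phi> (\<Union>w\<in>set xs. cell s w)}"
    for n and xs :: "'a list"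
  define E where "E n z = (\<Union>xs\<in>lattice_paths z (Suc n). A n xs)" for n and z :: 'a
  have A: "A n xs \<in> sets P" for n xs
    unfolding A_def
    by (intro borel_measurable_le borel_measurable_const point_process_measurable(1)[OF P] cells_borel
        finite_set)
  have E: "E n z \<in> sets P" for n z
    unfolding E_def using card_lattice_paths A by (intro sets.finite_UN) auto
  have A_le: "measure P (A n xs) \<le> e * (e / (2 * K)) ^ n" if xs: "xs \<in> lattice_paths z (Suc n)" for n z xs
  proof -
    have fs: "set xs \<subseteq> lattice" "card (set xs) = Suc n"
      using xs by (auto simp: lattice_paths_def distinct_card)
    have "measure P (A n xs) \<le>
        exp ((2 * K - 1) * (lam * measure lborel (\<Union>w\<in>set xs. cell s w))) / (2 * K) ^ n"
      unfolding A_def using K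
      by (intro idcx_tail_bound[OF P Q le cells_borel bounded_cells]) simp_all
    also have "measure lborel (\<Union>w\<in>set xs. cell s w) = real (Suc n) * s ^ DIM('a)"
      using measure_cells[OF s(1) finite_set fs(1)] fs(2) by simp
    also have "exp ((2 * K - 1) * (lam * (real (Suc n) * s ^ DIM('a)))) = e ^ Suc n"
      unfolding e_def by (simp only: mult_ac flip: exp_of_nat_mult)
    finally show ?thesis by (simp add: power_divide)
  qed
  have E_le: "measure P (E n z) \<le> e * (e / 2) ^ n" for n z
  proof -
    have "measure P (E n z) \<le> (\<Sum>xs\<in>lattice_paths z (Suc n). measure P (A n xs))"
      unfolding E_def using card_lattice_paths A by (intro finite_measure_subadditive_finite) auto
    also have "\<dots> \<le> (\<Sum>xs\<in>lattice_paths z (Suc n). e * (e / (2 * K)) ^ n)"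
      by (intro sum_mono A_le)
    also have "\<dots> = real (card (lattice_paths z (Suc n))) * (e * (e / (2 * K)) ^ n)" by simp
    also have "\<dots> \<le> K ^ n * (e * (e / (2 * K)) ^ n)"
    proof (rule mult_right_mono)
      have "card (lattice_paths z (Suc n)) \<le> card (steps :: 'a set) ^ n"
        using card_lattice_paths by blast
      then show "real (card (lattice_paths z (Suc n))) \<le> K ^ n"
        unfolding K_def by (metis of_nat_le_iff of_nat_power)
    qed (use e(1) K in simp)
    also have "\<dots> = e * (K * (e / (2 * K))) ^ n" by (simp only: power_mult_distrib mult_ac)
    also have "K * (e / (2 * K)) = e / 2" using K by simp
    finally show ?thesis .
  qed
  have lim: "(\<lambda>n. e * (e / 2) ^ n) \<longlonglongrightarrow> 0"
    using e by (intro tendsto_mult_right_zero LIMSEQ_realpow_zero) auto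
  have null: "(\<Inter>n. E n z) \<in> null_sets P" for z
  proof -
    have "measure P (\<Inter>n. E n z) \<le> e * (e / 2) ^ n" for n
      using finite_measure_mono[of "\<Inter>n. E n z" "E n z"] E E_le[of n z] by fastforce
    then have "measure P (\<Inter>n. E n z) \<le> 0"
      by (intro LIMSEQ_le_const[OF lim]) blast
    then have "emeasure P (\<Inter>n. E n z) = 0"
      by (simp add: emeasure_eq_measure measure_nonneg antisym)
    then show ?thesis using E by (simp add: null_sets_def)
  qed
  have "(\<Union>z\<in>lattice. \<Inter>n. E n z) \<in> null_sets P"
    using countable_lattice null by (rule null_sets_UN')
  moreover have "{\<phi> \<in> space P. percolates (covered_set 1 \<phi> r)} \<subseteq> (\<Union>z\<in>lattice. \<Inter>n. E n z)"
  proof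
    fix \<phi> assume "\<phi> \<in> {\<phi> \<in> space P. percolates (covered_set 1 \<phi> r)}"
    then have sp: "\<phi> \<in> space P" and perc: "percolates (covered_set 1 \<phi> r)" by simp_all
    then have phi: "\<phi> \<in> counting_measures" using point_processD(3)[OF P] by simp
    obtain S where S: "S \<subseteq> covered_set 1 \<phi> r" "connected S" "\<not> bounded S"
      using perc unfolding percolates_def by blast
    define T where "T = {z \<in> lattice. 1 \<le> emeasure \<phi> (cell s z)}"
    have "S \<subseteq> (\<Union>z\<in>T. fat_cell s z)"
      using covered_point_in_occupied_fat_cell[OF phi s] S(1) unfolding T_def by blast
    from long_lattice_path[OF s(1) S(2,3) this] obtain a where a: "a \<in> lattice"
      "\<And>n. \<exists>xs\<in>lattice_paths a (Suc n). set xs \<subseteq> T" unfolding T_def by blast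
    have "\<phi> \<in> E n a" for n
    proof -
      obtain xs where xs: "xs \<in> lattice_paths a (Suc n)" "set xs \<subseteq> T" using a(2) by blast
      have fs: "set xs \<subseteq> lattice" "card (set xs) = Suc n"
        using xs by (auto simp: lattice_paths_def distinct_card)
      have "of_nat (card (set xs)) = (\<Sum>w\<in>set xs. 1 :: ennreal)" by simp
      also have "\<dots> \<le> (\<Sum>w\<in>set xs. emeasure \<phi> (cell s w))"
        using xs(2) unfolding T_def by (intro sum_mono) blast
      also have "\<dots> = emeasure \<phi> (\<Union>w\<in>set xs. cell s w)"
        by (rule emeasure_cells[OF phi s(1) finite_set fs(1), symmetric])
      finally show ?thesis unfolding E_def A_def fs(2) using xs(1) sp by blast
    qed
    with a(1) show "\<phi> \<in> (\<Union>z\<in>lattice. \<Inter>n. E n z)" by blast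
  qed
  ultimately have "{\<phi> \<in> space P. percolates (covered_set 1 \<phi> r)} \<in> null_sets P"
    using null_sets_subset[OF _ percolates_measurable[OF P]] by blast
  then show ?thesis by (simp add: null_sets_def measure_def)
qed

lemma critical_radius_lower_bound:
  fixes lam :: real
  assumes lam: "0 < lam"
  shows "\<exists>c>0. \<forall>P Q :: 'a::euclidean_space measure measure.
    point_process P \<longrightarrow> poisson_process lam Q \<longrightarrow> le_order idcx P Q \<longrightarrow>
    ereal c \<le> critical_radius 1 P"
proof -
  define K where "K = real (card (steps :: 'a set))"
  have K: "1 \<le> K" using card_steps_ge_1[where 'a='a] by (simp add: K_def)
  \<comment> \<open>As \<open>s \<le> 1\<close>, \<open>s ^ DIM('a) \<le> s\<close>, and the second
    bound on \<open>s\<close> makes the exponent at most \<open>2 * K / (4 * K) = 1 / 2\<close>,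
    where \<open>exp (1 / 2) < 2\<close>.\<close>
  define s where "s = min 1 (1 / (4 * K * lam))"
  have s: "0 < s" "s \<le> 1" "s \<le> 1 / (4 * K * lam)" using K lam by (simp_all add: s_def)
  have "s ^ DIM('a) \<le> s ^ 1" using s DIM_positive[where 'a='a] by (intro power_decreasing) auto
  then have "lam * s ^ DIM('a) \<le> lam * (1 / (4 * K * lam))"
    using s(3) lam by (intro mult_left_mono) simp_all
  also have "\<dots> = 1 / (4 * K)" using lam by simp
  finally have "(2 * K - 1) * (lam * s ^ DIM('a)) \<le> (2 * K) * (1 / (4 * K))"
    using K lam s by (intro mult_mono) auto
  also have "\<dots> = 1 / 2" using K by simp
  finally have "exp ((2 * K - 1) * (lam * s ^ DIM('a))) \<le> exp (1 / 2)" by simp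
  also have "exp (1 / 2 :: real) < 2"
  proof (rule power2_less_imp_less)
    have "exp (1 / 2 :: real) ^ 2 = exp 1" by (simp flip: exp_of_nat_mult)
    then show "exp (1 / 2 :: real) ^ 2 < 2 ^ 2" using exp_le by simp
  qed simp
  finally have small: "exp ((2 * K - 1) * (lam * s ^ DIM('a))) < 2" .
  have "ereal (s / 3) \<le> critical_radius 1 P"
    if P: "point_process P" and Q: "poisson_process lam Q" and le: "le_order idcx P Q"
    for P Q :: "'a measure measure"
    unfolding critical_radius_def
  proof (rule Inf_greatest, clarify)
    fix r assume "measure P {\<phi> \<in> space P. percolates (covered_set 1 \<phi> r)} > 0"
    then have "\<not> r < s / 3"
      using measure_percolates_eq_0[OF P Q less_imp_le[OF lam] le s(1) _ small[unfolded K_def]] by force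
    then show "ereal (s / 3) \<le> ereal r" by simp
  qed
  with s(1) show ?thesis by (intro exI[of _ "s / 3"]) simp
qed

section \<open>The upper bound\<close>

lemma connected_closed_cell: "connected (closed_cell s z)"
proof -
  have "closed_cell s z = cbox (s *\<^sub>R z - (s/2) *\<^sub>R One) (s *\<^sub>R z + (s/2) *\<^sub>R One)" (is "_ = cbox ?l ?u")
  proof (rule set_eqI)
    fix x
    have "\<bar>x \<bullet> i - s * (z \<bullet> i)\<bar> \<le> s / 2 \<longleftrightarrow> ?l \<bullet> i \<le> x \<bullet> i \<and> x \<bullet> i \<le> ?u \<bullet> i" if "i \<in> Basis" for i
    proof -
      have "?l \<bullet> i = s * (z \<bullet> i) - s / 2" "?u \<bullet> i = s * (z \<bullet> i) + s / 2"
        using that by (simp_all add: inner_diff_left inner_add_left)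
      then show ?thesis by argo
    qed
    then show "x \<in> closed_cell s z \<longleftrightarrow> x \<in> cbox ?l ?u"
      unfolding closed_cell_def mem_box mem_Collect_eq by blast
  qed
  then show ?thesis by (simp add: convex_connected)
qed

lemma adjacent_closed_cells_meet:
  fixes z w :: "'a::euclidean_space"
  assumes "0 < s" "adjacent z w"
  shows "(s / 2) *\<^sub>R (z + w) \<in> closed_cell s z \<inter> closed_cell s w"
proof -
  have *: "(s / 2) *\<^sub>R (u + v) \<in> closed_cell s u" if "adjacent u v" for u v :: 'a
    unfolding closed_cell_def mem_Collect_eq
  proof
    fix i :: 'a assume "i \<in> Basis"
    then have le: "\<bar>u \<bullet> i - v \<bullet> i\<bar> \<le> 1" using that unfolding adjacent_def by blast
    have "((s / 2) *\<^sub>R (u + v)) \<bullet> i - s * (u \<bullet> i) = - (s / 2) * (u \<bullet> i - v \<bullet> i)"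
      by (simp add: inner_add_left field_simps)
    then have "\<bar>((s / 2) *\<^sub>R (u + v)) \<bullet> i - s * (u \<bullet> i)\<bar> = (s / 2) * \<bar>u \<bullet> i - v \<bullet> i\<bar>"
      using assms(1) by (simp add: abs_mult)
    also have "\<dots> \<le> (s / 2) * 1" using assms(1) le by (intro mult_left_mono) auto
    finally show "\<bar>((s / 2) *\<^sub>R (u + v)) \<bullet> i - s * (u \<bullet> i)\<bar> \<le> s / 2" by simp
  qed
  show ?thesis using *[OF assms(2)] *[OF adjacent_sym[OF assms(2)]] by (simp add: add.commute)
qed

text \<open>Consecutive closed cells share the midpoint of their centres, so by induction along a
  chain every point of the cluster is joined to \<open>s *\<^sub>R a\<close>.\<close>

lemma connected_cluster:
  assumes "0 < s" and R: "R = {z. (a, z) \<in> {(u, v). u \<in> T \<and> v \<in> T \<and> adjacent u v}\<^sup>*}"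
  shows "connected (\<Union>z\<in>R. closed_cell s z)"
proof -
  let ?E = "{(u, v). u \<in> T \<and> v \<in> T \<and> adjacent u v}"
  let ?K = "\<Union>z\<in>R. closed_cell s z"
  have aa: "s *\<^sub>R a \<in> closed_cell s a" using assms(1) by (simp add: closed_cell_def)
  have cc: "connected_component ?K x y"
    if "z \<in> R" "x \<in> closed_cell s z" "y \<in> closed_cell s z" for x y z
    using that connected_closed_cell[of s z] unfolding connected_component_def by blast
  have reach: "\<forall>x\<in>closed_cell s z. connected_component ?K (s *\<^sub>R a) x" if "(a, z) \<in> ?E\<^sup>*" for z
    using that
  proof (induction rule: rtrancl_induct)
    case base
    have "a \<in> R" by (simp add: R)
    then show ?case using cc aa by blast
  next
    case (step z w)
    from step.hyps have "w \<in> R" unfolding R by (blast intro: rtrancl_into_rtrancl)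
    moreover have "adjacent z w" using step.hyps(2) by blast
    then have "(s / 2) *\<^sub>R (z + w) \<in> closed_cell s z \<inter> closed_cell s w"
      by (rule adjacent_closed_cells_meet[OF assms(1)])
    ultimately show ?case
      using step.IH cc by (meson IntD1 IntD2 connected_component_trans)
  qed
  have "connected_component_set ?K (s *\<^sub>R a) = ?K"
  proof
    show "connected_component_set ?K (s *\<^sub>R a) \<subseteq> ?K" by (rule connected_component_subset)
    show "?K \<subseteq> connected_component_set ?K (s *\<^sub>R a)" using reach R by blast
  qed
  then show ?thesis using connected_connected_component[of ?K "s *\<^sub>R a"] by simp
qed

section \<open>Separating a bounded cluster from infinity\<close>

text \<open>The part of the ray beyond \<open>K\<close> lies in an unbounded component of the
  complement. This is \<open>D\<close>, because from dimension two on there is only one such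
  component; on the line there are two. The segment back to the origin leaves \<open>D\<close> and
  thus meets its frontier.\<close>

lemma ray_meets_frontier:
  fixes K :: "'a::euclidean_space set"
  assumes d: "2 \<le> DIM('a)" and K: "bounded K" "0 \<in> K"
    and D: "D \<in> components (- K)" "\<not> bounded D" and e: "norm e = 1"
  shows "\<exists>t\<ge>0. t *\<^sub>R e \<in> frontier D"
proof -
  obtain b where b: "\<And>x. x \<in> K \<Longrightarrow> norm x \<le> b" using K(1) unfolding bounded_iff by blast
  then have b0: "0 \<le> b" using K(2) by force
  define ray where "ray = (\<lambda>t. t *\<^sub>R e) ` {b + 1..}"
  have n: "norm (t *\<^sub>R e) = \<bar>t\<bar>" for t using e by simp
  have ray: "connected ray"
    unfolding ray_def by (intro connected_continuous_image continuous_intros) simp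
  have rayK: "ray \<subseteq> - K"
  proof
    fix x assume "x \<in> ray"
    then obtain t where "b + 1 \<le> t" "x = t *\<^sub>R e" by (auto simp: ray_def)
    then have "b < norm x" by (simp only: n)
    then show "x \<in> - K" using b[of x] by force
  qed
  have unb: "\<not> bounded ray"
  proof
    assume "bounded ray"
    then obtain c where c: "\<And>x. x \<in> ray \<Longrightarrow> norm x \<le> c" unfolding bounded_iff by blast
    have "(max (b + 1) (c + 1)) *\<^sub>R e \<in> ray" unfolding ray_def by (intro imageI) simp
    from c[OF this] show False unfolding n by simp
  qed
  let ?p = "(b + 1) *\<^sub>R e"
  have p: "?p \<in> ray" unfolding ray_def by (intro imageI) simp
  let ?C = "connected_component_set (- K) ?p"
  have sub: "ray \<subseteq> ?C" by (rule connected_component_maximal[OF p ray rayK])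
  have C: "?C \<in> components (- K)" using p rayK unfolding components_iff by blast
  have "\<not> bounded ?C" using unb sub bounded_subset by blast
  then have "?C = D"
    using cobounded_unique_unbounded_components[OF _ D C _ d] K(1) by simp
  with sub p have pD: "?p \<in> D" by blast
  define seg where "seg = (\<lambda>t. t *\<^sub>R e) ` {0..b + 1}"
  have "connected seg"
    unfolding seg_def by (intro connected_continuous_image continuous_intros) simp
  moreover have "?p \<in> seg" unfolding seg_def using b0 by (intro imageI) simp
  moreover have "0 \<in> seg" unfolding seg_def using b0 by (intro image_eqI[of _ _ 0]) simp_all
  moreover have "0 \<notin> D" using in_components_subset[OF D(1)] K(2) by blast
  ultimately have "seg \<inter> frontier D \<noteq> {}" using pD by (intro connected_Int_frontier) blast+
  then obtain t where "0 \<le> t" "t *\<^sub>R e \<in> frontier D" unfolding seg_def by auto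
  then show ?thesis by blast
qed

text \<open>Off the axis the integer coordinates are smaller than 1 in absolute value, hence 0;
  along it the coordinate exceeds -1. The possible first cubes of a surrounding path are thus
  indexed by a natural number.\<close>

lemma fat_cell_on_axis:
  assumes s: "0 < s" and e: "e \<in> Basis" and t: "0 \<le> t" and z: "z \<in> lattice" "t *\<^sub>R e \<in> fat_cell s z"
  shows "\<exists>j::nat. z = real j *\<^sub>R e"
proof -
  have off: "z \<bullet> i = 0" if i: "i \<in> Basis" "i \<noteq> e" for i
  proof -
    have "\<bar>(t *\<^sub>R e) \<bullet> i - s * (z \<bullet> i)\<bar> < 5/6 * s"
      using z(2) i(1) unfolding fat_cell_def by blast
    then have "s * \<bar>z \<bullet> i\<bar> < s * 1" using s i e by (simp add: inner_Basis abs_mult)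
    then have "\<bar>z \<bullet> i\<bar> < 1" using s by (simp only: mult_less_cancel_left_pos)
    moreover have "z \<bullet> i \<in> \<int>" using z(1) i(1) by (simp add: lattice_def)
    ultimately show ?thesis by (metis Ints_nonzero_abs_less1)
  qed
  have "\<bar>(t *\<^sub>R e) \<bullet> e - s * (z \<bullet> e)\<bar> < 5/6 * s" using z(2) e unfolding fat_cell_def by blast
  then have "\<bar>t - s * (z \<bullet> e)\<bar> < 5/6 * s" using e by simp
  then have "s * (- 1) < s * (z \<bullet> e)" using t s by argo
  then have gt: "- 1 < z \<bullet> e" using s by (simp only: mult_less_cancel_left_pos)
  obtain m where m: "z \<bullet> e = of_int m" using z(1) e unfolding lattice_def by (auto elim: Ints_cases)
  then have "0 \<le> m" using gt by simp
  then have me: "z \<bullet> e = real (nat m)" using m by simp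
  have "z = real (nat m) *\<^sub>R e"
    by (rule euclidean_eqI) (use e me off in \<open>auto simp: inner_Basis\<close>)
  then show ?thesis ..
qed

lemma uminus_lattice: "- z \<in> lattice \<longleftrightarrow> z \<in> lattice"
  by (simp add: lattice_def)

text \<open>Reflection reduces the negative half axis to the positive one.\<close>

lemma uminus_fat_cell: "- x \<in> fat_cell s (- z) \<longleftrightarrow> x \<in> fat_cell s z"
proof -
  have "\<bar>(- x) \<bullet> i - s * ((- z) \<bullet> i)\<bar> = \<bar>x \<bullet> i - s * (z \<bullet> i)\<bar>" for i by simp
  then show ?thesis unfolding fat_cell_def mem_Collect_eq by metis
qed

text \<open>A Peierls argument: if the cluster of the filled cells at the origin is bounded, then the
  frontier of the unbounded component of its complement is connected, runs through cells that are
  not filled, and meets both halves of the axis \<open>e\<close>.\<close>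

lemma surrounding_path:
  fixes T :: "'a::euclidean_space set"
  assumes d: "2 \<le> DIM('a)" and s: "0 < s" and T: "T \<subseteq> lattice" and e: "e \<in> Basis"
    and bdd: "\<And>S. \<lbrakk>connected S; S \<subseteq> (\<Union>z\<in>T. closed_cell s z)\<rbrakk> \<Longrightarrow> bounded S"
  shows "\<exists>j. \<exists>xs\<in>lattice_paths (real j *\<^sub>R e) (Suc j). set xs \<inter> T = {}"
proof (cases "0 \<in> T")
  case False
  \<comment> \<open>If the cube at the origin is not filled, it is by itself a path for
    \<open>j = 0\<close>.\<close>
  have "[0] \<in> lattice_paths (real 0 *\<^sub>R e) (Suc 0)" by (simp add: lattice_paths_def lattice_def)
  moreover have "set [0] \<inter> T = {}" using False by simp
  ultimately show ?thesis by blast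
next
  case True
  let ?E = "{(u, v). u \<in> T \<and> v \<in> T \<and> adjacent u v}"
  define R where "R = {z. (0, z) \<in> ?E\<^sup>*}"
  define K where "K = (\<Union>z\<in>R. closed_cell s z)"
  have RT: "R \<subseteq> T"
  proof
    fix z assume "z \<in> R"
    then have "(0, z) \<in> ?E\<^sup>*" by (simp add: R_def)
    then show "z \<in> T" by (cases rule: rtranclE) (use True in blast)+
  qed
  have zero: "0 \<in> K"
  proof -
    have "0 \<in> R" by (simp add: R_def)
    moreover have "0 \<in> closed_cell s 0" using s by (simp add: closed_cell_def)
    ultimately show ?thesis unfolding K_def by blast
  qed
  have conK: "connected K" unfolding K_def by (rule connected_cluster[OF s R_def])
  have bK: "bounded K" using conK RT by (intro bdd) (auto simp: K_def)
  then obtain D where D: "D \<in> components (- K)" "\<not> bounded D"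
    using cobounded_unbounded_components[of "- K"] by auto
  \<comment> \<open>Unicoherence of euclidean space: a component of the complement of a connected
    set has connected frontier.\<close>
  have conF: "connected (frontier D)"
    by (rule connected_frontier_component_complement[OF conK D(1)])
  define U where "U = {z \<in> lattice. z \<notin> T}"
  have cover: "frontier D \<subseteq> (\<Union>z\<in>U. fat_cell s z)"
  proof
    fix x assume "x \<in> frontier D"
    then have "x \<in> frontier K"
      using frontier_of_components_subset[OF D(1)] by (auto simp: frontier_complement)
    then have "x \<in> closure K" "x \<in> closure (- K)" by (auto simp: frontier_closures)
    then have "\<exists>y\<in>K. dist y x < s / 3" "\<exists>y\<in>- K. dist y x < s / 3"
      using s unfolding closure_approachable by (metis divide_pos_pos zero_less_numeral)+
    then obtain y y' where y: "y \<in> K" "dist y x < s / 3" and y': "y' \<in> - K" "dist y' x < s / 3"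
      by blast
    obtain w where w: "w \<in> R" "y \<in> closed_cell s w" using y(1) unfolding K_def by blast
    obtain z where z: "z \<in> lattice" "y' \<in> cell s z" using ex_cell[OF s] .
    have zR: "z \<notin> R" using y'(1) z(2) cell_subset_closed_cell unfolding K_def by blast
    have xw: "x \<in> fat_cell s w" by (rule closed_cell_dist_fat_cell[OF w(2) y(2)])
    have xz: "x \<in> fat_cell s z" by (rule cell_dist_fat_cell[OF z(2) y'(2)])
    have wT: "w \<in> T" using w(1) RT by blast
    then have "adjacent w z" using fat_cells_adjacent[OF s _ z(1), of w] T xw xz by blast
    \<comment> \<open>A filled neighbour of the cluster would belong to it, but \<open>z\<close>
      contains a point outside \<open>K\<close>.\<close>
    have "z \<notin> T"
    proof
      assume "z \<in> T"
      with wT \<open>adjacent w z\<close> have "(w, z) \<in> ?E" by blast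
      with w(1) have "z \<in> R" unfolding R_def by (blast intro: rtrancl_into_rtrancl)
      with zR show False ..
    qed
    with z(1) xz show "x \<in> (\<Union>z\<in>U. fat_cell s z)" unfolding U_def by blast
  qed
  have ne: "norm e = 1" "norm (- e) = 1" using e by simp_all
  obtain t1 where t1: "0 \<le> t1" "t1 *\<^sub>R e \<in> frontier D"
    using ray_meets_frontier[OF d bK zero D ne(1)] by blast
  obtain t2 where t2: "0 \<le> t2" "t2 *\<^sub>R (- e) \<in> frontier D"
    using ray_meets_frontier[OF d bK zero D ne(2)] by blast
  obtain a where a: "a \<in> U" "t1 *\<^sub>R e \<in> fat_cell s a" using cover t1(2) by blast
  obtain b where b: "b \<in> U" "t2 *\<^sub>R (- e) \<in> fat_cell s b" using cover t2(2) by blast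
  have UL: "U \<subseteq> lattice" by (auto simp: U_def)
  obtain j :: nat where j: "a = real j *\<^sub>R e" using fat_cell_on_axis[OF s e t1(1) _ a(2)] a(1) UL by blast
  have "t2 *\<^sub>R e \<in> fat_cell s (- b)" using b(2) uminus_fat_cell[of "t2 *\<^sub>R (- e)" s b] by simp
  moreover have "- b \<in> lattice" using b(1) UL by (auto simp: uminus_lattice)
  ultimately obtain i :: nat where i: "- b = real i *\<^sub>R e" using fat_cell_on_axis[OF s e t2(1)] by blast
  obtain xs where xs: "xs \<in> lattice_paths a (length xs)" "last xs = b" "set xs \<subseteq> U"
    using fat_cell_path[OF s conF cover UL a(1) t1(2) a(2) b(1) t2(2) b(2)] by metis
  have "successively adjacent xs" "xs \<noteq> []" "hd xs = a" using xs(1) by (simp_all add: lattice_paths_def)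
  from successively_adjacent_dist[OF this(1,2) e] this(3) xs(2)
  have "\<bar>a \<bullet> e - b \<bullet> e\<bar> \<le> real (length xs) - 1" by simp
  moreover have "a \<bullet> e = real j" using j e by simp
  moreover have "(- b) \<bullet> e = real i" using i e by simp
  then have "b \<bullet> e = - real i" by simp
  \<comment> \<open>The path passes from coordinate \<open>j\<close> to \<open>- i\<close> along
    \<open>e\<close>, so it has at least \<open>j + 1\<close> cubes. Tying the length to the
    starting point makes the union bound over all \<open>j\<close> summable.\<close>
  ultimately have "Suc j \<le> length xs" by simp
  then have "take (Suc j) xs \<in> lattice_paths (real j *\<^sub>R e) (Suc j)"
    using take_lattice_paths[OF xs(1)] j by simp
  moreover have "set (take (Suc j) xs) \<inter> T = {}"
    using xs(3) set_take_subset[of "Suc j" xs] unfolding U_def by blast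
  ultimately show ?thesis by blast
qed

section \<open>Large radii: percolation with positive probability\<close>

text \<open>Two points of a closed cell differ by at most \<open>s\<close> in each coordinate, so
  the ball of radius \<open>DIM('a) * s\<close> around \<open>x\<close> contains the whole cell and
  its \<open>k\<close> points.\<close>

lemma filled_cell_covered:
  fixes \<phi> :: "'a::euclidean_space measure" and s :: real
  assumes phi: "\<phi> \<in> counting_measures" and filled: "of_nat k \<le> emeasure \<phi> (cell s z)"
    and x: "x \<in> closed_cell s z"
  shows "x \<in> covered_set k \<phi> (real DIM('a) * s)"
proof -
  have sb: "sets \<phi> = sets borel" using phi by (simp add: counting_measures_def)
  have sub: "cell s z \<subseteq> cball x (real DIM('a) * s)"
  proof
    fix y assume "y \<in> cell s z"
    then have y: "y \<in> closed_cell s z" using cell_subset_closed_cell by blast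
    have "norm (x - y) \<le> real DIM('a) * s"
    proof (rule norm_le_sum_coords)
      fix i :: 'a assume "i \<in> Basis"
      then have "\<bar>x \<bullet> i - s * (z \<bullet> i)\<bar> \<le> s / 2" "\<bar>y \<bullet> i - s * (z \<bullet> i)\<bar> \<le> s / 2"
        using x y unfolding closed_cell_def by blast+
      then show "\<bar>(x - y) \<bullet> i\<bar> \<le> s" unfolding inner_diff_left by argo
    qed
    then show "y \<in> cball x (real DIM('a) * s)" by (simp add: dist_norm)
  qed
  note filled
  also have "emeasure \<phi> (cell s z) \<le> emeasure \<phi> (cball x (real DIM('a) * s))"
    by (intro emeasure_mono sub) (simp add: sb)
  finally show ?thesis unfolding covered_set_eq[OF phi] by blast
qed

text \<open>Percolation can fail only if some surrounding path of \<open>j + 1\<close> unfilled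
  cubes exists. Each cube costs a factor \<open>q \<le> 1 / (8 * K)\<close>, which absorbs the
  number of paths and leaves a geometric series with sum below 1.\<close>

lemma measure_percolates_pos:
  fixes P Q :: "'a::euclidean_space measure measure" and s :: real
  assumes d: "2 \<le> DIM('a)"
    and P: "point_process P" and Q: "poisson_process lam Q" "0 \<le> lam" and le: "le_order ddcx P Q"
    and s: "0 < s"
    and small: "exp (real (k - 1) + (exp (- 1) - 1) * (lam * s ^ DIM('a))) \<le>
      1 / (8 * real (card (steps :: 'a set)))"
  shows "0 < measure P {\<phi> \<in> space P. percolates (covered_set k \<phi> (real DIM('a) * s))}"
proof -
  interpret prob_space P using point_processD[OF P] by simp
  define K where "K = real (card (steps :: 'a set))"
  have K: "1 \<le> K" using card_steps_ge_1[where 'a='a] by (simp add: K_def)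
  define q where "q = exp (real (k - 1) + (exp (- 1) - 1) * (lam * s ^ DIM('a)))"
  have q: "0 < q" "q \<le> 1 / (8 * K)" using small by (simp_all add: q_def K_def)
  obtain e :: 'a where e: "e \<in> Basis" using nonempty_Basis by blast
  define A where "A n xs = {\<phi> \<in> space P. emeasure \<phi> (\<Union>w\<in>set xs. cell s w) \<le> of_nat (n * (k - 1))}"
    for n and xs :: "'a list"
  define E where "E j = (\<Union>xs\<in>lattice_paths (real j *\<^sub>R e) (Suc j). A (Suc j) xs)" for j
  have A: "A n xs \<in> sets P" for n xs
    unfolding A_def
    by (intro borel_measurable_le borel_measurable_const point_process_measurable(1)[OF P] cells_borel
        finite_set)
  have E: "E j \<in> sets P" for j
    unfolding E_def using card_lattice_paths A by (intro sets.finite_UN) auto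
  have A_le: "measure P (A (Suc n) xs) \<le> exp 1 * q ^ Suc n" if xs: "xs \<in> lattice_paths z (Suc n)"
    for n z xs
  proof -
    have fs: "set xs \<subseteq> lattice" "card (set xs) = Suc n"
      using xs by (auto simp: lattice_paths_def distinct_card)
    have "measure P (A (Suc n) xs) \<le> exp (real (Suc n * (k - 1)) + 1) *
        exp ((exp (- 1) - 1) * (lam * measure lborel (\<Union>w\<in>set xs. cell s w)))"
      unfolding A_def by (intro ddcx_tail_bound[OF P Q le cells_borel bounded_cells]) simp_all
    also have "measure lborel (\<Union>w\<in>set xs. cell s w) = real (Suc n) * s ^ DIM('a)"
      using measure_cells[OF s finite_set fs(1)] fs(2) by simp
    also have "exp (real (Suc n * (k - 1)) + 1) *
        exp ((exp (- 1) - 1) * (lam * (real (Suc n) * s ^ DIM('a)))) =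
        exp 1 * exp (real (Suc n) * (real (k - 1) + (exp (- 1) - 1) * (lam * s ^ DIM('a))))"
      unfolding exp_add[symmetric] of_nat_mult by (simp only: distrib_left mult_ac add_ac)
    also have "\<dots> = exp 1 * q ^ Suc n"
      unfolding q_def by (simp only: exp_of_nat_mult)
    finally show ?thesis .
  qed
  \<comment> \<open>The bound is \<open>3 * (1 / 8) ^ (j + 1)\<close>, where 3 dominates the factor
    \<open>exp 1\<close> of the tail bound. Its sum over \<open>j\<close> is
    \<open>3 / 7\<close>.\<close>
  have E_le: "measure P (E j) \<le> (3 / 8) * (1 / 8) ^ j" for j
  proof -
    let ?L = "lattice_paths (real j *\<^sub>R e) (Suc j)"
    have "measure P (E j) \<le> (\<Sum>xs\<in>?L. measure P (A (Suc j) xs))"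
      unfolding E_def using card_lattice_paths A by (intro finite_measure_subadditive_finite) auto
    also have "\<dots> \<le> (\<Sum>xs\<in>?L. exp 1 * q ^ Suc j)"
      by (intro sum_mono A_le)
    also have "\<dots> = real (card ?L) * (exp 1 * q ^ Suc j)" by simp
    also have "\<dots> \<le> K ^ Suc j * (3 * (1 / (8 * K)) ^ Suc j)"
    proof (rule mult_mono)
      have "card ?L \<le> card (steps :: 'a set) ^ j"
        using card_lattice_paths by blast
      then have "real (card ?L) \<le> K ^ j"
        unfolding K_def by (metis of_nat_le_iff of_nat_power)
      also have "\<dots> \<le> K ^ Suc j" using K by (intro power_increasing) simp_all
      finally show "real (card ?L) \<le> K ^ Suc j" .
      show "exp 1 * q ^ Suc j \<le> 3 * (1 / (8 * K)) ^ Suc j"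
        using q exp_le by (intro mult_mono power_mono) simp_all
    qed (use q K in simp_all)
    also have "\<dots> = 3 * (K * (1 / (8 * K))) ^ Suc j" by (simp only: power_mult_distrib mult_ac)
    also have "K * (1 / (8 * K)) = 1 / 8" using K by simp
    finally show ?thesis by simp
  qed
  have geo: "(\<lambda>j. (3 / 8) * (1 / 8 :: real) ^ j) sums ((3 / 8) * (1 / (1 - 1 / 8)))"
    by (intro sums_mult geometric_sums) simp
  have sumE: "summable (\<lambda>j. measure P (E j))"
    by (rule summable_comparison_test'[OF sums_summable[OF geo]]) (use E_le in simp)
  have "measure P (\<Union>j. E j) \<le> (\<Sum>j. measure P (E j))"
    using E sumE by (intro finite_measure_subadditive_countably) auto
  also have "\<dots> \<le> (\<Sum>j. (3 / 8) * (1 / 8 :: real) ^ j)"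
    by (intro suminf_le E_le sumE sums_summable[OF geo])
  also have "\<dots> < 1" unfolding sums_unique[OF geo, symmetric] by simp
  finally have lt: "measure P (\<Union>j. E j) < 1" .
  let ?G = "{\<phi> \<in> space P. percolates (covered_set k \<phi> (real DIM('a) * s))}"
  have G: "?G \<in> sets P" by (rule percolates_measurable[OF P])
  have "space P - ?G \<subseteq> (\<Union>j. E j)"
  proof
    fix \<phi> assume "\<phi> \<in> space P - ?G"
    then have sp: "\<phi> \<in> space P" and nperc: "\<not> percolates (covered_set k \<phi> (real DIM('a) * s))" by simp_all
    then have phi: "\<phi> \<in> counting_measures" using point_processD(3)[OF P] by simp
    define T where "T = {z \<in> lattice. of_nat k \<le> emeasure \<phi> (cell s z)}"
    have TL: "T \<subseteq> lattice" by (auto simp: T_def)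
    have cov: "(\<Union>z\<in>T. closed_cell s z) \<subseteq> covered_set k \<phi> (real DIM('a) * s)"
      using filled_cell_covered[OF phi] unfolding T_def by blast
    have "bounded S" if "connected S" "S \<subseteq> (\<Union>z\<in>T. closed_cell s z)" for S
      using nperc that subset_trans[OF that(2) cov] unfolding percolates_def by blast
    from surrounding_path[OF d s TL e this] obtain j xs
      where xs: "xs \<in> lattice_paths (real j *\<^sub>R e) (Suc j)" "set xs \<inter> T = {}" by blast
    have fs: "set xs \<subseteq> lattice" "card (set xs) = Suc j"
      using xs(1) by (auto simp: lattice_paths_def distinct_card)
    have "emeasure \<phi> (\<Union>w\<in>set xs. cell s w) = (\<Sum>w\<in>set xs. emeasure \<phi> (cell s w))"
      by (rule emeasure_cells[OF phi s finite_set fs(1)])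
    also have "\<dots> \<le> (\<Sum>w\<in>set xs. of_nat (k - 1))"
    proof (rule sum_mono)
      fix w assume w: "w \<in> set xs"
      obtain n :: nat where n: "emeasure \<phi> (cell s w) = of_nat n"
        using phi cell_borel bounded_cell by (rule counting_measureE)
      have "\<not> of_nat k \<le> emeasure \<phi> (cell s w)" using w xs(2) fs(1) unfolding T_def by blast
      \<comment> \<open>An unfilled cube has \<open>n < k\<close>, so \<open>k\<close> is positive
        here and the truncated difference \<open>k - 1\<close> is the true one.\<close>
      then have "n \<le> k - 1" unfolding n of_nat_le_iff by simp
      then show "emeasure \<phi> (cell s w) \<le> of_nat (k - 1)" unfolding n of_nat_le_iff .
    qed
    also have "\<dots> = of_nat (Suc j * (k - 1))" unfolding sum_constant fs(2) of_nat_mult ..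
    finally show "\<phi> \<in> (\<Union>j. E j)" unfolding E_def A_def using xs(1) sp by blast
  qed
  then have "measure P (space P - ?G) \<le> measure P (\<Union>j. E j)"
    using E by (intro finite_measure_mono) auto
  with lt have "1 - measure P ?G < 1" unfolding prob_compl[OF G] by simp
  then show ?thesis by simp
qed

text \<open>The condition on the dimension stands inside the existential, so that a function of
  \<open>lam\<close> and \<open>k\<close> can be extracted without a case split on the
  dimension.\<close>

lemma critical_radius_upper_bound:
  fixes lam :: real and k :: nat
  assumes lam: "0 < lam"
  shows "\<exists>c :: real. 2 \<le> DIM('a) \<longrightarrow> (\<forall>P Q :: 'a::euclidean_space measure measure.
    point_process P \<longrightarrow> poisson_process lam Q \<longrightarrow> le_order ddcx P Q \<longrightarrow>
    critical_radius k P \<le> ereal c)"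
proof -
  define K where "K = real (card (steps :: 'a set))"
  have K: "1 \<le> K" using card_steps_ge_1[where 'a='a] by (simp add: K_def)
  define b where "b = (1 - exp (- 1 :: real)) * lam"
  have b: "0 < b" using lam by (simp add: b_def)
  define a where "a = real (k - 1) + ln (8 * K)"
  \<comment> \<open>As \<open>1 \<le> s\<close>, \<open>s \<le> s ^ DIM('a)\<close>, so
    \<open>b * s ^ DIM('a)\<close> is at least \<open>a\<close> and the exponent in the smallness
    condition is at most \<open>- ln (8 * K)\<close>.\<close>
  define s where "s = max 1 (a / b)"
  have s: "1 \<le> s" "a / b \<le> s" by (simp_all add: s_def)
  have "s ^ 1 \<le> s ^ DIM('a)" using s(1) DIM_positive[where 'a='a] by (intro power_increasing) auto
  then have "a / b \<le> s ^ DIM('a)" using s(2) by simp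
  then have "a \<le> b * s ^ DIM('a)" using b by (simp add: field_simps)
  moreover have "(exp (- 1) - 1) * (lam * s ^ DIM('a)) = - (b * s ^ DIM('a))"
    unfolding b_def by (simp add: algebra_simps)
  ultimately have "real (k - 1) + (exp (- 1) - 1) * (lam * s ^ DIM('a)) \<le> - ln (8 * K)"
    unfolding a_def by linarith
  then have "exp (real (k - 1) + (exp (- 1) - 1) * (lam * s ^ DIM('a))) \<le> exp (- ln (8 * K))"
    by simp
  also have "\<dots> = 1 / (8 * K)" using K by (simp add: exp_minus field_simps)
  finally have small: "exp (real (k - 1) + (exp (- 1) - 1) * (lam * s ^ DIM('a))) \<le> 1 / (8 * K)" .
  have "critical_radius k P \<le> ereal (real DIM('a) * s)"
    if "2 \<le> DIM('a)" "point_process P" "poisson_process lam Q" "le_order ddcx P Q"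
    for P Q :: "'a measure measure"
  proof -
    have "0 < measure P {\<phi> \<in> space P. percolates (covered_set k \<phi> (real DIM('a) * s))}"
      using measure_percolates_pos[OF that(1-3) less_imp_le[OF lam] that(4) _ small[unfolded K_def]] s(1)
      by simp
    then show ?thesis
      unfolding critical_radius_def using s(1) by (intro Inf_lower) auto
  qed
  then show ?thesis by blast
qed

section \<open>Monotonicity in \<open>k\<close> and comparison of the orders\<close>

lemma critical_radius_mono:
  assumes P: "point_process P" and "j \<le> k"
  shows "critical_radius j P \<le> critical_radius k P"
  unfolding critical_radius_def
proof (rule Inf_superset_mono, clarify)
  interpret prob_space P using point_processD[OF P] by simp
  fix r assume r: "0 \<le> r" "0 < measure P {\<phi> \<in> space P. percolates (covered_set k \<phi> r)}"
  have sub: "covered_set k \<phi> r \<subseteq> covered_set j \<phi> r" for \<phi> :: "'a measure"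
  proof -
    have "(of_nat j :: ennreal) \<le> of_nat k" using assms(2) unfolding of_nat_le_iff .
    then show ?thesis unfolding covered_set_def using order_trans by blast
  qed
  have "{\<phi> \<in> space P. percolates (covered_set k \<phi> r)} \<subseteq> {\<phi> \<in> space P. percolates (covered_set j \<phi> r)}"
    using sub unfolding percolates_def by blast
  then have "measure P {\<phi> \<in> space P. percolates (covered_set k \<phi> r)} \<le>
      measure P {\<phi> \<in> space P. percolates (covered_set j \<phi> r)}"
    by (intro finite_measure_mono percolates_measurable[OF P])
  with r show "\<exists>r'. ereal r = ereal r' \<and> 0 \<le> r' \<and>
      0 < measure P {\<phi> \<in> space P. percolates (covered_set j \<phi> r')}" by force
qed

text \<open>Fewer test functions impose fewer inequalities, so the comparison under
  \<open>dcx\<close> contains both of the others.\<close>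

lemma le_order_antimono:
  assumes "le_order G P Q" "\<And>m. F m \<subseteq> G m"
  shows "le_order F P Q"
  unfolding le_order_def
proof (intro allI impI ballI)
  fix m :: nat and B f
  assume "1 \<le> m" "\<forall>i<m. B i \<in> sets borel \<and> bounded (B i)" "f \<in> F m"
    and int: "integrable P (\<lambda>\<phi>. f (counts m B \<phi>)) \<and> integrable Q (\<lambda>\<phi>. f (counts m B \<phi>))"
  moreover have "f \<in> G m" using \<open>f \<in> F m\<close> assms(2) by blast
  ultimately show "(\<integral>\<phi>. f (counts m B \<phi>) \<partial>P) \<le> (\<integral>\<phi>. f (counts m B \<phi>) \<partial>Q)"
    using assms(1) unfolding le_order_def by blast
qed

lemma le_order_dcx_imp:
  assumes "le_order dcx P Q"
  shows "le_order idcx P Q" "le_order ddcx P Q"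
  by (rule le_order_antimono[OF assms], simp add: idcx_def ddcx_def)+

text \<open>The upper bound is stated from dimension two on because it fails on the line: a Poisson
  process is comparable with itself, yet for every \<open>r\<close> it almost surely leaves gaps
  longer than \<open>2 * r\<close> arbitrarily far out in both directions, so its critical radius is
  infinite.\<close>

theorem proposition5p3:
  shows "\<exists>(c1 :: real \<Rightarrow> real) (c2 :: real \<Rightarrow> nat \<Rightarrow> real).
    \<forall>lam>0. \<forall>k\<ge>1.
      0 < c1 lam \<and>
      (\<forall>(\<Phi> :: 'a::euclidean_space measure measure) (\<Phi>lam :: 'a measure measure).
        point_process \<Phi> \<and> stationary \<Phi> \<and> poisson_process lam \<Phi>lam \<longrightarrow>
        (le_order idcx \<Phi> \<Phi>lam \<longrightarrow>
           ereal (c1 lam) \<le> critical_radius 1 \<Phi>) \<and>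
        (le_order ddcx \<Phi> \<Phi>lam \<longrightarrow> 2 \<le> DIM('a) \<longrightarrow>
           critical_radius k \<Phi> \<le> ereal (c2 lam k)) \<and>
        (le_order dcx \<Phi> \<Phi>lam \<longrightarrow>
           ereal (c1 lam) \<le> critical_radius 1 \<Phi> \<and>
           critical_radius 1 \<Phi> \<le> critical_radius k \<Phi> \<and>
           (2 \<le> DIM('a) \<longrightarrow> critical_radius k \<Phi> \<le> ereal (c2 lam k))))"
proof -
  \<comment> \<open>In both bounds the constant precedes the quantifiers over processes, so choice
    yields functions of \<open>lam\<close>, respectively of \<open>lam\<close> and \<open>k\<close>,
    that do not depend on the laws.\<close>
  obtain c1 :: "real \<Rightarrow> real" where c1: "\<And>lam. 0 < lam \<Longrightarrow> 0 < c1 lam \<and>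
      (\<forall>P Q :: 'a measure measure. point_process P \<longrightarrow> poisson_process lam Q \<longrightarrow>
        le_order idcx P Q \<longrightarrow> ereal (c1 lam) \<le> critical_radius 1 P)"
    using critical_radius_lower_bound[where 'a='a] by metis
  obtain c2 :: "real \<Rightarrow> nat \<Rightarrow> real" where c2: "\<And>lam k. 0 < lam \<Longrightarrow> 2 \<le> DIM('a) \<longrightarrow>
      (\<forall>P Q :: 'a measure measure. point_process P \<longrightarrow> poisson_process lam Q \<longrightarrow>
        le_order ddcx P Q \<longrightarrow> critical_radius k P \<le> ereal (c2 lam k))"
    using critical_radius_upper_bound[where 'a='a] by metis
  show ?thesis
  proof (rule exI[of _ c1], rule exI[of _ c2], intro allI impI)
    fix lam :: real and k :: nat
    assume lam: "0 < lam" and k: "1 \<le> k"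
    show "0 < c1 lam \<and>
      (\<forall>(\<Phi> :: 'a measure measure) (\<Phi>lam :: 'a measure measure).
        point_process \<Phi> \<and> stationary \<Phi> \<and> poisson_process lam \<Phi>lam \<longrightarrow>
        (le_order idcx \<Phi> \<Phi>lam \<longrightarrow>
           ereal (c1 lam) \<le> critical_radius 1 \<Phi>) \<and>
        (le_order ddcx \<Phi> \<Phi>lam \<longrightarrow> 2 \<le> DIM('a) \<longrightarrow>
           critical_radius k \<Phi> \<le> ereal (c2 lam k)) \<and>
        (le_order dcx \<Phi> \<Phi>lam \<longrightarrow>
           ereal (c1 lam) \<le> critical_radius 1 \<Phi> \<and>
           critical_radius 1 \<Phi> \<le> critical_radius k \<Phi> \<and>
           (2 \<le> DIM('a) \<longrightarrow> critical_radius k \<Phi> \<le> ereal (c2 lam k))))"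
    proof (rule conjI, use c1[OF lam] in blast, intro allI impI)
      fix P Q :: "'a measure measure"
      assume "point_process P \<and> stationary P \<and> poisson_process lam Q"
      then have P: "point_process P" and Q: "poisson_process lam Q" by blast+
      have lower: "le_order idcx P Q \<Longrightarrow> ereal (c1 lam) \<le> critical_radius 1 P"
        using c1[OF lam] P Q by blast
      have upper: "le_order ddcx P Q \<Longrightarrow> 2 \<le> DIM('a) \<Longrightarrow> critical_radius k P \<le> ereal (c2 lam k)"
        using c2[OF lam, of k] P Q by blast
      show "(le_order idcx P Q \<longrightarrow> ereal (c1 lam) \<le> critical_radius 1 P) \<and>
        (le_order ddcx P Q \<longrightarrow> 2 \<le> DIM('a) \<longrightarrow> critical_radius k P \<le> ereal (c2 lam k)) \<and>
        (le_order dcx P Q \<longrightarrow> ereal (c1 lam) \<le> critical_radius 1 P \<and>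
           critical_radius 1 P \<le> critical_radius k P \<and>
           (2 \<le> DIM('a) \<longrightarrow> critical_radius k P \<le> ereal (c2 lam k)))"
        using lower upper le_order_dcx_imp[of P Q] critical_radius_mono[OF P k] by blast
    qed
  qed
qed

end
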